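(* Let $(X,Y)$ be a pair of random variables with finite alphabets and joint pmf $p_{X,Y}$, and let $R^*_{\mathrm{TV}}$ be the approximate common information rate of the discrete memoryless source $(X,Y)$. Then $$R^*_{\mathrm{TV}}=J(X;Y).$$
   Context: All random variables are discrete; $I$ denotes mutual information (base 2). The Wyner common information is $J(X;Y)=\min_{W:\,X\to W\to Y}I(W;X,Y)$, where $X\to W\to Y$ means that $X$ and $Y$ are conditionally independent given $W$ (the joint pmf of $(X,Y)$ being fixed). A $(W_n,R,n)$ simulation code consists of: (i) a discrete common random variable $W_n$, with $R=\frac1n\min_{\mathcal C}\mathsf{E}(L)$, where the minimum is over all variable-length prefix-free zero-error binary codes $\mathcal C\subset\{0,1\}^*$ for $W_n$ and $L$ is the length of the codeword of $W_n$; (ii) stochastic decoders $p_{\hat X^n|W_n}$ and $p_{\hat Y^n|W_n}$, with $\hat X^n$ and $\hat Y^n$ conditionally independent given $W_n$. The source $(X,Y)$ can be approximately generated at rate $R$ if there is a sequence of $(W_n,R,n)$ simulation codes for which the total variation distance between $p_{\hat X^n,\hat Y^n}(x^n,y^n)$ and $\prod_{i=1}^np_{X,Y}(x_i,y_i)$ tends to $0$ as $n\to\infty$. The approximate common information rate $R^*_{\mathrm{TV}}$ is the infimum of all rates $R$ at which $(X,Y)$ can be approximately generated. *)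

theory Defs
  imports "HOL-Probability.Probability" "HOL-Library.Sublist"
begin

text \<open>
  The alphabets of X and Y are finite types and the joint law of (X, Y) is a pmf on pairs.
  Auxiliary discrete random variables W take values in the naturals. This is no restriction:
  a discrete random variable has countable support, and every quantity below is invariant
  under relabelling of the values of W.
\<close>

definition markov_chain :: "'s pmf \<Rightarrow> ('s \<Rightarrow> 'a) \<Rightarrow> ('s \<Rightarrow> 'w) \<Rightarrow> ('s \<Rightarrow> 'b) \<Rightarrow> bool" where
  "markov_chain q X W Y \<longleftrightarrow>
     (\<forall>w\<in>W ` set_pmf q. \<forall>x y.
        \<P>(s in q. X s = x \<and> Y s = y \<bar> W s = w) =
        \<P>(s in q. X s = x \<bar> W s = w) * \<P>(s in q. Y s = y \<bar> W s = w))"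

text \<open>
  A coupling \<open>q\<close> is the joint law of (W, (X, Y)) with fixed (X, Y)-marginal. The set of values is
  nonempty and its minimum is attained, so the minimum is rendered by \<open>LEAST\<close>.
\<close>

definition wyner_common_information :: "('a::finite \<times> 'b::finite) pmf \<Rightarrow> real" where
  "wyner_common_information p =
     (LEAST v. \<exists>q :: (nat \<times> 'a \<times> 'b) pmf.
        map_pmf snd q = p \<and>
        markov_chain q (fst \<circ> snd) fst (snd \<circ> snd) \<and>
        v = prob_space.mutual_information q 2 (count_space UNIV) (count_space UNIV) fst snd)"

text \<open>
  Zero error means that the encoder is injective on the support; symbols of probability zero
  need no codeword. A deterministic W may be encoded by the empty word.
\<close>

definition prefix_free_code :: "'w pmf \<Rightarrow> ('w \<Rightarrow> bool list) \<Rightarrow> bool" where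
  "prefix_free_code W c \<longleftrightarrow>
     inj_on c (set_pmf W) \<and>
     (\<forall>u\<in>c ` set_pmf W. \<forall>v\<in>c ` set_pmf W. prefix u v \<longrightarrow> u = v)"

definition expected_length :: "'w pmf \<Rightarrow> ('w \<Rightarrow> bool list) \<Rightarrow> ennreal" where
  "expected_length W c = (\<integral>\<^sup>+ w. ennreal (real (length (c w))) \<partial>measure_pmf W)"

definition is_min_expected_length :: "'w pmf \<Rightarrow> ennreal \<Rightarrow> bool" where
  "is_min_expected_length W l \<longleftrightarrow>
     (\<exists>c. prefix_free_code W c \<and> expected_length W c = l) \<and>
     (\<forall>c. prefix_free_code W c \<longrightarrow> l \<le> expected_length W c)"

text \<open>
  The rate satisfies \<open>n R = min E(L)\<close>, which is finite. The condition \<open>0 \<le> R\<close> is needed because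
  \<open>ennreal\<close> sends negative reals to 0. Words over an alphabet are lists of length \<open>n\<close>.
\<close>

definition simulation_code ::
  "nat pmf \<Rightarrow> (nat \<Rightarrow> 'a list pmf) \<Rightarrow> (nat \<Rightarrow> 'b list pmf) \<Rightarrow> real \<Rightarrow> nat \<Rightarrow> bool" where
  "simulation_code W decX decY R n \<longleftrightarrow>
     0 < n \<and> 0 \<le> R \<and> is_min_expected_length W (ennreal (real n * R)) \<and>
     (\<forall>w\<in>set_pmf W. (\<forall>xs\<in>set_pmf (decX w). length xs = n) \<and>
                    (\<forall>ys\<in>set_pmf (decY w). length ys = n))"

definition code_output ::
  "nat pmf \<Rightarrow> (nat \<Rightarrow> 'a list pmf) \<Rightarrow> (nat \<Rightarrow> 'b list pmf) \<Rightarrow> ('a list \<times> 'b list) pmf" where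
  "code_output W decX decY = bind_pmf W (\<lambda>w. pair_pmf (decX w) (decY w))"

definition memoryless_source :: "('a \<times> 'b) pmf \<Rightarrow> nat \<Rightarrow> ('a list \<times> 'b list) pmf" where
  "memoryless_source p n = map_pmf (\<lambda>zs. (map fst zs, map snd zs)) (replicate_pmf n p)"

definition total_variation :: "'c pmf \<Rightarrow> 'c pmf \<Rightarrow> real" where
  "total_variation P Q = (\<Sum>\<^sub>\<infinity>z. \<bar>pmf P z - pmf Q z\<bar>) / 2"

text \<open>
  The codes are required to have rate exactly \<open>R\<close> for all sufficiently large \<open>n\<close>. The requirement
  cannot be imposed at every \<open>n \<ge> 1\<close>: a minimal expected codeword length is never strictly
  between 0 and 1, so no code with \<open>0 < R < 1\<close> exists at \<open>n = 1\<close>.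
\<close>

definition approximately_generable :: "('a::finite \<times> 'b::finite) pmf \<Rightarrow> real \<Rightarrow> bool" where
  "approximately_generable p R \<longleftrightarrow>
     (\<exists>(W :: nat \<Rightarrow> nat pmf) (decX :: nat \<Rightarrow> nat \<Rightarrow> 'a list pmf) (decY :: nat \<Rightarrow> nat \<Rightarrow> 'b list pmf).
        (\<forall>\<^sub>F n in sequentially. simulation_code (W n) (decX n) (decY n) R n) \<and>
        (\<lambda>n. total_variation (code_output (W n) (decX n) (decY n)) (memoryless_source p n))
          \<longlonglongrightarrow> 0)"

definition approximate_common_information_rate :: "('a::finite \<times> 'b::finite) pmf \<Rightarrow> real" where
  "approximate_common_information_rate p = Inf {R. approximately_generable p R}"

end

theory Submission
  imports Defs "HOL-Real_Asymp.Real_Asymp"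
begin

text \<open>
  Write \<open>F(r)\<close> for the largest value of \<open>H(X,Y|W)\<close> over all decompositions of a law \<open>r\<close> into product
  laws, so that \<open>J = H(p) - F(p)\<close>. As a concave envelope, \<open>F\<close> is dominated near \<open>p\<close> by an affine
  function: for every \<open>\<epsilon>\<close> there is a \<open>g\<close> with \<open>H(A) + H(B) \<le> E\<^bsub>A \<times> B\<^esub> g\<close> for all \<open>A\<close>, \<open>B\<close>
  and \<open>E\<^bsub>p\<^esub> g \<le> F(p) + \<epsilon>\<close>.

  Converse: by Kraft's inequality \<open>n R = E L\<close> is at least \<open>H(Z) - H(Z|W)\<close> for the output
  \<open>Z\<close>. Conditionally on \<open>W\<close> every coordinate of the output has a product law, so subadditivity and
  \<open>g\<close> give \<open>H(Z|W) \<le> E (\<Sum>i. g(Z\<^sub>i)) \<approx> n E\<^bsub>p\<^esub> g\<close>, while \<open>H(Z) \<ge> n H(p) - o(n)\<close> because \<open>Z\<close> is close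
  in total variation to the source.

  Achievability: for \<open>R > J\<close> a random codebook of \<open>2 ^ nat \<lfloor>n R\<rfloor>\<close> words drawn from the optimal \<open>W\<close>
  generates the source up to vanishing total variation when its words are used uniformly. The
  index is refined to a dyadic random variable whose optimal code has expected length exactly
  \<open>n R\<close>; dyadic rates \<open>R\<close> suffice for the infimum.
\<close>

section \<open>Entropy and product laws on lists\<close>

text \<open>Three obstacles shape the details. (1) The output law is only close to \<open>p\<close>,
  so a converse by single-letterization calls for a time-sharing variable and continuity of the
  common information in the source. The affine bound \<open>g\<close> does the work of both: it
  holds for every product law, adds up over coordinates, and its mean depends only on the output
  law, so it moves little in total variation. It also reaches auxiliary variables with infinitely
  many values, which finite mixtures do not. (2) \<open>W\<close> may have infinite support, so the
  chain \<open>I(W;Z) \<le> H(W) \<le> E L\<close> is not formed; Kraft's inequality is compared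
  directly with a function of \<open>w\<close> dominated by \<open>- log 2 (pmf W w)\<close>. (3)
  The minimal expected length must equal \<open>n R\<close> exactly, whereas a uniform index on
  \<open>2 ^ k\<close> words yields only integers. Splitting some leaves of the complete tree
  supplies the fractional part, and for dyadic \<open>R\<close> and large \<open>n\<close> the match
  is exact.\<close>

lemma log2_le_linear:
  fixes x :: real assumes "0 < x" shows "log 2 x \<le> (x - 1) / ln 2"
  using ln_le_minus_one[OF assms] by (simp add: log_def divide_right_mono)

definition pmf_entropy :: "'c pmf \<Rightarrow> real" where
  "pmf_entropy P = measure_pmf.expectation P (\<lambda>x. - log 2 (pmf P x))"

lemma expectation_mono_finite:
  fixes f g :: "'c \<Rightarrow> real"
  assumes "finite (set_pmf P)" "\<And>x. x \<in> set_pmf P \<Longrightarrow> f x \<le> g x"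
  shows "measure_pmf.expectation P f \<le> measure_pmf.expectation P g"
  using assms by (intro integral_mono_AE integrable_measure_pmf_finite) (auto simp: AE_measure_pmf_iff)

lemma expectation_cong_pmf:
  fixes f g :: "'c \<Rightarrow> real"
  assumes "\<And>x. x \<in> set_pmf P \<Longrightarrow> f x = g x"
  shows "measure_pmf.expectation P f = measure_pmf.expectation P g"
  using assms by (intro integral_cong_AE) (auto simp: AE_measure_pmf_iff)

text \<open>Average \<open>log 2 t \<le> (t - 1) / ln 2\<close> under \<open>P\<close> with
  \<open>t = pmf Q x / pmf P x\<close>. Since \<open>log 2 0 = 0\<close>, a point of
  \<open>P\<close> missed by \<open>Q\<close> would contribute 0 instead of infinity on the right;
  the inclusion of supports excludes this.\<close>

lemma pmf_gibbs:
  assumes fin: "finite (set_pmf P)" and sub: "set_pmf P \<subseteq> set_pmf Q"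
  shows "pmf_entropy P \<le> measure_pmf.expectation P (\<lambda>x. - log 2 (pmf Q x))"
proof -
  have int: "integrable (measure_pmf P) f" for f :: "_ \<Rightarrow> real"
    using fin by (rule integrable_measure_pmf_finite)
  have "measure_pmf.expectation P (\<lambda>x. log 2 (pmf Q x) - log 2 (pmf P x))
      \<le> measure_pmf.expectation P (\<lambda>x. (pmf Q x / pmf P x - 1) / ln 2)"
  proof (rule expectation_mono_finite[OF fin])
    fix x assume x: "x \<in> set_pmf P"
    then have "0 < pmf P x" "0 < pmf Q x" using sub by (auto intro: pmf_positive)
    then show "log 2 (pmf Q x) - log 2 (pmf P x) \<le> (pmf Q x / pmf P x - 1) / ln 2"
      using log2_le_linear[of "pmf Q x / pmf P x"] by (simp add: log_divide)
  qed
  also have "\<dots> = (measure_pmf.expectation P (\<lambda>x. pmf Q x / pmf P x) - 1) / ln 2"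
    by (simp add: int)
  also have "measure_pmf.expectation P (\<lambda>x. pmf Q x / pmf P x) = (\<Sum>x\<in>set_pmf P. pmf Q x)"
    by (subst integral_measure_pmf[OF fin]) (auto intro!: sum.cong simp: set_pmf_iff)
  also have "\<dots> \<le> 1"
    using measure_pmf.prob_le_1[of Q "set_pmf P"] by (simp add: measure_measure_pmf_finite[OF fin])
  finally have "measure_pmf.expectation P (\<lambda>x. log 2 (pmf Q x) - log 2 (pmf P x)) \<le> 0"
    by (simp add: divide_right_mono)
  then show ?thesis by (simp add: pmf_entropy_def int)
qed

text \<open>The factors may differ, because given a codeword each coordinate is produced from its
  own channel input.\<close>

primrec seq_pmf :: "'c pmf list \<Rightarrow> 'c list pmf" where
  "seq_pmf [] = return_pmf []"
| "seq_pmf (P # Ps) = map_pmf (\<lambda>(x, xs). x # xs) (pair_pmf P (seq_pmf Ps))"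

lemma replicate_pmf_eq_seq_pmf: "replicate_pmf n P = seq_pmf (replicate n P)"
  by (induction n) (simp_all add: pair_pmf_def map_bind_pmf bind_assoc_pmf bind_return_pmf)

lemma length_seq_pmf: "xs \<in> set_pmf (seq_pmf Ps) \<Longrightarrow> length xs = length Ps"
  by (induction Ps arbitrary: xs) auto

lemma finite_set_seq_pmf:
  "(\<And>P. P \<in> set Ps \<Longrightarrow> finite (set_pmf P)) \<Longrightarrow> finite (set_pmf (seq_pmf Ps))"
  by (induction Ps) (auto simp: case_prod_beta)

lemma pmf_seq_pmf_Cons: "pmf (seq_pmf (P # Ps)) (x # xs) = pmf P x * pmf (seq_pmf Ps) xs"
proof -
  have "inj (\<lambda>(x::'a, xs). x # xs)" by (auto simp: inj_def)
  from pmf_map_inj'[OF this, of "pair_pmf P (seq_pmf Ps)" "(x, xs)"]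
  show ?thesis by (simp add: pmf_pair)
qed

lemma pmf_seq_pmf:
  "length xs = length Ps \<Longrightarrow> pmf (seq_pmf Ps) xs = (\<Prod>i<length Ps. pmf (Ps ! i) (xs ! i))"
proof (induction Ps arbitrary: xs)
  case (Cons P Ps)
  then obtain y ys where "xs = y # ys" by (cases xs) auto
  with Cons show ?case
    by (simp add: pmf_seq_pmf_Cons prod.lessThan_Suc_shift del: seq_pmf.simps prod.lessThan_Suc)
qed simp

lemma log2_pmf_seq_pmf:
  assumes "length xs = length Ps" "\<And>i. i < length Ps \<Longrightarrow> xs ! i \<in> set_pmf (Ps ! i)"
  shows "log 2 (pmf (seq_pmf Ps) xs) = (\<Sum>i<length Ps. log 2 (pmf (Ps ! i) (xs ! i)))"
proof -
  have "ln (\<Prod>i<length Ps. pmf (Ps ! i) (xs ! i)) = (\<Sum>i<length Ps. ln (pmf (Ps ! i) (xs ! i)))"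
    using assms by (intro ln_prod) (auto simp: pmf_eq_0_set_pmf)
  then show ?thesis by (simp add: pmf_seq_pmf assms(1) log_def sum_divide_distrib)
qed

text \<open>Subadditivity of entropy: Gibbs' inequality against the product of the law's own
  marginals.\<close>

lemma pmf_entropy_list_le:
  assumes fin: "finite (set_pmf P)" and len: "\<And>xs. xs \<in> set_pmf P \<Longrightarrow> length xs = n"
  shows "pmf_entropy P \<le> (\<Sum>i<n. pmf_entropy (map_pmf (\<lambda>xs. xs ! i) P))"
proof -
  define Ps where "Ps = map (\<lambda>i. map_pmf (\<lambda>xs. xs ! i) P) [0..<n]"
  have Ps: "length Ps = n" "\<And>i. i < n \<Longrightarrow> Ps ! i = map_pmf (\<lambda>xs. xs ! i) P"
    by (simp_all add: Ps_def)
  have in_marg: "xs ! i \<in> set_pmf (Ps ! i)" if "xs \<in> set_pmf P" "i < n" for xs i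
    using that by (auto simp: Ps)
  have "pmf_entropy P \<le> measure_pmf.expectation P (\<lambda>xs. - log 2 (pmf (seq_pmf Ps) xs))"
  proof (rule pmf_gibbs[OF fin], rule subsetI)
    fix xs assume "xs \<in> set_pmf P"
    then have "pmf (seq_pmf Ps) xs \<noteq> 0"
      using in_marg len by (auto simp: pmf_seq_pmf Ps(1) pmf_eq_0_set_pmf)
    then show "xs \<in> set_pmf (seq_pmf Ps)" by (simp add: set_pmf_iff)
  qed
  also have "\<dots> = measure_pmf.expectation P (\<lambda>xs. \<Sum>i<n. - log 2 (pmf (Ps ! i) (xs ! i)))"
    by (rule expectation_cong_pmf)
      (use in_marg len in \<open>simp add: log2_pmf_seq_pmf[where Ps = Ps, unfolded Ps(1)] sum_negf\<close>)
  also have "\<dots> = (\<Sum>i<n. measure_pmf.expectation P (\<lambda>xs. - log 2 (pmf (Ps ! i) (xs ! i))))"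
    by (intro Bochner_Integration.integral_sum integrable_measure_pmf_finite fin)
  also have "\<dots> = (\<Sum>i<n. pmf_entropy (map_pmf (\<lambda>xs. xs ! i) P))"
    by (simp add: pmf_entropy_def Ps)
  finally show ?thesis .
qed

lemma pmf_entropy_pair:
  assumes "finite (set_pmf A)" "finite (set_pmf B)"
  shows "pmf_entropy (pair_pmf A B) = pmf_entropy A + pmf_entropy B"
proof -
  have int: "integrable (measure_pmf (pair_pmf A B)) f" for f :: "_ \<Rightarrow> real"
    using assms by (intro integrable_measure_pmf_finite) simp
  have "pmf_entropy (pair_pmf A B) = measure_pmf.expectation (pair_pmf A B) (\<lambda>z. - log 2 (pmf A (fst z)) + - log 2 (pmf B (snd z)))"
    unfolding pmf_entropy_def
    by (rule expectation_cong_pmf) (auto simp: pmf_pair log_mult pmf_eq_0_set_pmf)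
  also have "\<dots> = pmf_entropy A + pmf_entropy B"
    by (subst Bochner_Integration.integral_add[OF int int])
      (simp only: pmf_entropy_def expectation_pair_pmf_fst[where f="\<lambda>x. - log 2 (pmf A x)"]
        expectation_pair_pmf_snd[where f="\<lambda>x. - log 2 (pmf B x)"])
  finally show ?thesis .
qed

section \<open>The weak law for independent samples\<close>

lemma expectation_pair_pmf_finite:
  fixes f :: "'c \<times> 'd \<Rightarrow> real"
  assumes "finite (set_pmf A)" "finite (set_pmf B)"
  shows "measure_pmf.expectation (pair_pmf A B) f
    = measure_pmf.expectation A (\<lambda>x. measure_pmf.expectation B (\<lambda>y. f (x, y)))"
proof -
  have "measure_pmf.expectation (pair_pmf A B) f = (\<Sum>(x,y)\<in>set_pmf A \<times> set_pmf B. pmf A x * pmf B y * f (x, y))"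
    using assms by (subst integral_measure_pmf[of "set_pmf A \<times> set_pmf B"]) (auto simp: pmf_pair intro!: sum.cong)
  also have "\<dots> = (\<Sum>x\<in>set_pmf A. \<Sum>y\<in>set_pmf B. pmf A x * pmf B y * f (x, y))"
    by (simp add: sum.cartesian_product)
  also have "\<dots> = measure_pmf.expectation A (\<lambda>x. measure_pmf.expectation B (\<lambda>y. f (x, y)))"
    using assms by (simp add: integral_measure_pmf[of "set_pmf A"] integral_measure_pmf[of "set_pmf B"]
       sum_distrib_left mult.assoc)
  finally show ?thesis .
qed

lemma finite_set_replicate_pmf: "finite (set_pmf q) \<Longrightarrow> finite (set_pmf (replicate_pmf n q))"
  by (auto simp: replicate_pmf_eq_seq_pmf intro!: finite_set_seq_pmf)

lemma replicate_pmf_Suc_pair: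
  "replicate_pmf (Suc n) q = map_pmf (\<lambda>(x, xs). x # xs) (pair_pmf q (replicate_pmf n q))"
  by (simp add: replicate_pmf_eq_seq_pmf)

lemma expectation_replicate_sum_list:
  fixes f :: "'c \<Rightarrow> real"
  assumes fin: "finite (set_pmf q)"
  shows "measure_pmf.expectation (replicate_pmf n q) (\<lambda>xs. sum_list (map f xs))
    = real n * measure_pmf.expectation q f"
proof (induction n)
  case (Suc n)
  have int: "integrable (measure_pmf q) g" "integrable (measure_pmf (replicate_pmf n q)) h"
    for g h :: "_ \<Rightarrow> real"
    using fin by (auto intro!: integrable_measure_pmf_finite finite_set_replicate_pmf)
  show ?case
    unfolding replicate_pmf_Suc_pair integral_map_pmf
    by (subst expectation_pair_pmf_finite)
      (simp_all add: Suc fin finite_set_replicate_pmf int algebra_simps del: replicate_pmf.simps)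
qed simp

text \<open>Induction on the length; the cross terms vanish because \<open>f\<close> has mean
  zero.\<close>

lemma expectation_replicate_sum_list_square:
  fixes f :: "'c \<Rightarrow> real"
  assumes fin: "finite (set_pmf q)" and zero: "measure_pmf.expectation q f = 0"
  shows "measure_pmf.expectation (replicate_pmf n q) (\<lambda>xs. (sum_list (map f xs))\<^sup>2)
    = real n * measure_pmf.expectation q (\<lambda>x. (f x)\<^sup>2)"
proof (induction n)
  case (Suc n)
  have int: "integrable (measure_pmf q) g" "integrable (measure_pmf (replicate_pmf n q)) h"
    for g h :: "_ \<Rightarrow> real"
    using fin by (auto intro!: integrable_measure_pmf_finite finite_set_replicate_pmf)
  show ?case
    unfolding replicate_pmf_Suc_pair integral_map_pmf
    by (subst expectation_pair_pmf_finite)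
      (simp_all add: Suc fin finite_set_replicate_pmf int zero expectation_replicate_sum_list
        power2_sum algebra_simps del: replicate_pmf.simps)
qed simp

lemma prob_le_expectation:
  fixes f :: "'c \<Rightarrow> real"
  assumes "finite (set_pmf P)" "\<And>x. x \<in> set_pmf P \<Longrightarrow> 0 \<le> f x"
    "\<And>x. x \<in> set_pmf P \<Longrightarrow> x \<in> S \<Longrightarrow> 1 \<le> f x"
  shows "measure_pmf.prob P S \<le> measure_pmf.expectation P f"
proof -
  have "measure_pmf.prob P S = measure_pmf.expectation P (indicat_real S)" by simp
  also have "\<dots> \<le> measure_pmf.expectation P f"
    by (rule expectation_mono_finite) (use assms in \<open>auto simp: indicator_def\<close>)
  finally show ?thesis .
qed

lemma replicate_pmf_chebyshev:
  fixes f :: "'c \<Rightarrow> real"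
  assumes fin: "finite (set_pmf q)" and \<delta>: "0 < \<delta>" and n: "0 < n"
  defines "\<mu> \<equiv> measure_pmf.expectation q f"
  shows "measure_pmf.prob (replicate_pmf n q) {xs. real n * \<delta> \<le> \<bar>sum_list (map f xs) - real n * \<mu>\<bar>}
    \<le> measure_pmf.expectation q (\<lambda>x. (f x - \<mu>)\<^sup>2) / \<delta>\<^sup>2 / real n" (is "measure_pmf.prob ?R ?S \<le> _")
proof -
  let ?h = "\<lambda>x. f x - \<mu>"
  have int: "integrable (measure_pmf q) g" for g :: "_ \<Rightarrow> real"
    using fin by (rule integrable_measure_pmf_finite)
  have sum: "sum_list (map ?h xs) = sum_list (map f xs) - real n * \<mu>" if "xs \<in> set_pmf ?R" for xs
    using that by (simp add: sum_list_subtractf set_replicate_pmf sum_list_triv)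
  have "measure_pmf.prob ?R ?S \<le> measure_pmf.expectation ?R (\<lambda>xs. (sum_list (map ?h xs))\<^sup>2 / (real n * \<delta>)\<^sup>2)"
  proof (rule prob_le_expectation)
    fix xs assume "xs \<in> set_pmf ?R" "xs \<in> ?S"
    then have "(real n * \<delta>)\<^sup>2 \<le> (sum_list (map ?h xs))\<^sup>2"
      using \<delta> sum by (intro iffD1[OF abs_le_square_iff]) auto
    then show "1 \<le> (sum_list (map ?h xs))\<^sup>2 / (real n * \<delta>)\<^sup>2" using \<delta> n by simp
  qed (auto simp: fin finite_set_replicate_pmf)
  also have "\<dots> = real n * measure_pmf.expectation q (\<lambda>x. (?h x)\<^sup>2) / (real n * \<delta>)\<^sup>2"
    using fin by (simp add: expectation_replicate_sum_list_square int \<mu>_def)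
  also have "\<dots> = measure_pmf.expectation q (\<lambda>x. (?h x)\<^sup>2) / \<delta>\<^sup>2 / real n"
    using n by (simp add: power2_eq_square field_simps)
  finally show ?thesis .
qed

lemma replicate_pmf_weak_law:
  fixes f :: "'c \<Rightarrow> real"
  assumes "finite (set_pmf q)" "0 < \<delta>"
  shows "(\<lambda>n. measure_pmf.prob (replicate_pmf n q)
      {xs. real n * \<delta> \<le> \<bar>sum_list (map f xs) - real n * measure_pmf.expectation q f\<bar>}) \<longlonglongrightarrow> 0"
proof -
  let ?V = "measure_pmf.expectation q (\<lambda>x. (f x - measure_pmf.expectation q f)\<^sup>2) / \<delta>\<^sup>2"
  have "\<forall>\<^sub>F n in sequentially. measure_pmf.prob (replicate_pmf n q)
      {xs. real n * \<delta> \<le> \<bar>sum_list (map f xs) - real n * measure_pmf.expectation q f\<bar>} \<le> ?V / real n"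
    using eventually_gt_at_top[of 0] by eventually_elim (rule replicate_pmf_chebyshev[OF assms])
  then show ?thesis
    by (rule tendsto_sandwich[rotated, OF _ tendsto_const lim_const_over_n]) simp
qed

section \<open>Mutual information over finite alphabets\<close>

definition eta :: "real \<Rightarrow> real" where "eta t = - (t * log 2 t)"

lemma eta_nonneg: "0 \<le> t \<Longrightarrow> t \<le> 1 \<Longrightarrow> 0 \<le> eta t"
  by (cases "t = 0") (auto simp: eta_def mult_le_0_iff)

text \<open>Crude (the maximum is \<open>1 / (e ln 2)\<close>); a uniform bound is what makes
  entropies integrable over an infinite index.\<close>

lemma eta_le: assumes "0 \<le> t" shows "eta t \<le> 1 / ln 2"
proof (cases "t = 0")
  case False
  with assms have "0 < t" by simp
  then have "- log 2 t \<le> (1 / t - 1) / ln 2"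
    using log2_le_linear[of "1 / t"] by (simp add: log_divide)
  then have "t * - log 2 t \<le> t * ((1 / t - 1) / ln 2)"
    using \<open>0 < t\<close> by (intro mult_left_mono) auto
  also have "\<dots> \<le> 1 / ln 2" using \<open>0 < t\<close> by (simp add: field_simps)
  finally show ?thesis by (simp add: eta_def)
qed (simp add: eta_def)

text \<open>At 0 this is the limit of \<open>t * ln t\<close>. It makes entropy continuous on the
  closed simplex, which the compactness argument below relies on.\<close>

lemma continuous_on_eta: "continuous_on {0..} eta"
proof -
  have "continuous (at t within {0..}) eta" if "0 \<le> t" for t
  proof (cases "t = 0")
    case True
    have "((\<lambda>t::real. t * ln t) \<longlongrightarrow> 0) (at_right 0)" by real_asymp
    from tendsto_minus[OF tendsto_divide[OF this tendsto_const[of "ln 2"]]]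
    have "(eta \<longlongrightarrow> 0) (at_right 0)"
      by (simp add: eta_def[abs_def] log_def)
    then show ?thesis using True
      by (simp add: continuous_within eta_def at_within_Ici_at_right)
  next
    case False
    then show ?thesis using that unfolding eta_def
      by (intro continuous_intros) auto
  qed
  then show ?thesis by (simp add: continuous_on_eq_continuous_within)
qed

lemma expectation_finite_type:
  fixes P :: "'c::finite pmf" and f :: "'c \<Rightarrow> real"
  shows "measure_pmf.expectation P f = (\<Sum>x\<in>UNIV. pmf P x * f x)"
  by (simp add: integral_measure_pmf[of UNIV])

lemma pmf_entropy_eq_sum_eta:
  fixes P :: "'c::finite pmf"
  shows "pmf_entropy P = (\<Sum>x\<in>UNIV. eta (pmf P x))"
  by (simp only: pmf_entropy_def expectation_finite_type eta_def mult_minus_right)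

lemma pmf_entropy_nonneg:
  fixes P :: "'c::finite pmf"
  shows "0 \<le> pmf_entropy P"
  by (simp add: pmf_entropy_eq_sum_eta sum_nonneg eta_nonneg pmf_le_1)

lemma pmf_entropy_bound:
  fixes P :: "'c::finite pmf"
  shows "\<bar>pmf_entropy P\<bar> \<le> real CARD('c) / ln 2"
  using pmf_entropy_nonneg[of P] sum_mono[of UNIV "\<lambda>x. eta (pmf P x)" "\<lambda>_. 1 / ln 2"]
  by (simp add: pmf_entropy_eq_sum_eta eta_le)

section \<open>Averages over an index with possibly infinite support\<close>

lemma integrable_expectation_finite:
  fixes V :: "'w \<Rightarrow> 'c pmf" and g :: "'c \<Rightarrow> real"
  assumes Z: "finite Z" "\<And>w. w \<in> set_pmf W \<Longrightarrow> set_pmf (V w) \<subseteq> Z"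
  shows "integrable (measure_pmf W) (\<lambda>w. measure_pmf.expectation (V w) g)"
proof (rule measure_pmf.integrable_const_bound[where B = "\<Sum>x\<in>Z. \<bar>g x\<bar>"])
  have "\<bar>measure_pmf.expectation (V w) g\<bar> \<le> (\<Sum>x\<in>Z. \<bar>g x\<bar>)" if "w \<in> set_pmf W" for w
  proof -
    have "measure_pmf.expectation (V w) g = (\<Sum>x\<in>Z. pmf (V w) x * g x)"
      using Z(2)[OF that] by (subst integral_measure_pmf[OF Z(1)]) auto
    then show ?thesis
      by (auto simp: abs_mult mult_left_le_one_le pmf_le_1 intro!: sum_mono order.trans[OF sum_abs])
  qed
  then show "AE w in measure_pmf W. norm (measure_pmf.expectation (V w) g) \<le> (\<Sum>x\<in>Z. \<bar>g x\<bar>)"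
    by (simp add: AE_measure_pmf_iff)
qed simp

lemma expectation_bind_finite:
  fixes V :: "'w \<Rightarrow> 'c pmf" and g :: "'c \<Rightarrow> real"
  assumes Z: "finite Z" "\<And>w. w \<in> set_pmf W \<Longrightarrow> set_pmf (V w) \<subseteq> Z"
  shows "measure_pmf.expectation (bind_pmf W V) g
    = measure_pmf.expectation W (\<lambda>w. measure_pmf.expectation (V w) g)"
proof -
  have "measure_pmf.expectation W (\<lambda>w. measure_pmf.expectation (V w) g)
      = measure_pmf.expectation W (\<lambda>w. \<Sum>x\<in>Z. pmf (V w) x * g x)"
    by (rule expectation_cong_pmf, subst integral_measure_pmf[OF Z(1)]) (use Z(2) in auto)
  also have "\<dots> = (\<Sum>x\<in>Z. measure_pmf.expectation W (\<lambda>w. pmf (V w) x * g x))"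
  proof (intro Bochner_Integration.integral_sum)
    show "integrable (measure_pmf W) (\<lambda>w. pmf (V w) x * g x)" for x
      by (rule measure_pmf.integrable_const_bound[where B = "\<bar>g x\<bar>"])
        (auto simp: abs_mult mult_left_le_one_le pmf_le_1)
  qed
  also have "\<dots> = (\<Sum>x\<in>Z. pmf (bind_pmf W V) x * g x)"
    by (simp add: pmf_bind)
  also have "\<dots> = measure_pmf.expectation (bind_pmf W V) g"
    using Z by (subst integral_measure_pmf[OF Z(1)]) auto
  finally show ?thesis ..
qed

lemmas expectation_bind_finite_type = expectation_bind_finite[OF finite_class.finite_UNIV subset_UNIV]
lemmas integrable_expectation_finite_type = integrable_expectation_finite[OF finite_class.finite_UNIV subset_UNIV]

lemma integrable_pmf_entropy:
  fixes A :: "'w \<Rightarrow> 'c::finite pmf"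
  shows "integrable (measure_pmf W) (\<lambda>w. pmf_entropy (A w))"
  by (rule measure_pmf.integrable_const_bound[where B = "real CARD('c) / ln 2"])
    (auto simp: pmf_entropy_bound)

definition channel_joint :: "'w pmf \<Rightarrow> ('w \<Rightarrow> 'c pmf) \<Rightarrow> ('w \<times> 'c) pmf" where
  "channel_joint W V = bind_pmf W (\<lambda>w. map_pmf (Pair w) (V w))"

lemma pmf_channel_joint: "pmf (channel_joint W V) (w, z) = pmf W w * pmf (V w) z"
proof -
  have "pmf (map_pmf (Pair v) (V v)) (w, z) = (if v = w then pmf (V v) z else 0)" for v
    using pmf_map_inj'[of "Pair v" "V v" z] by (auto simp: inj_def pmf_eq_0_set_pmf)
  then have "pmf (channel_joint W V) (w, z)
      = measure_pmf.expectation W (\<lambda>v. if v = w then pmf (V v) z else 0)"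
    by (simp add: channel_joint_def pmf_bind)
  also have "\<dots> = pmf W w * pmf (V w) z"
    by (subst integral_measure_pmf[of "{w}"]) (auto split: if_splits)
  finally show ?thesis .
qed

lemma map_fst_channel_joint: "map_pmf fst (channel_joint W V) = W"
  by (simp add: channel_joint_def map_bind_pmf map_pmf_comp map_pmf_const bind_return_pmf')

lemma map_snd_channel_joint: "map_pmf snd (channel_joint W V) = bind_pmf W V"
  by (simp add: channel_joint_def map_bind_pmf map_pmf_comp)

lemma distributed_pmf:
  "distributed (measure_pmf q) (count_space UNIV) X (\<lambda>x. ennreal (pmf (map_pmf X q) x))"
  by (simp add: distributed_def measure_pmf_eq_density[symmetric] map_pmf_rep_eq)

text \<open>Reduces the measure-theoretic mutual information to a divergence averaged over
  \<open>W\<close>. All laws are densities with respect to counting measures; countability of the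
  index type makes the product of the two counting measures a counting measure again. Integrability
  has to be shown for Fubini, as \<open>W\<close> may be infinite.\<close>

lemma mutual_information_channel_joint:
  fixes W :: "'w::countable pmf" and V :: "'w \<Rightarrow> 'c::finite pmf"
  shows "prob_space.mutual_information (channel_joint W V) 2 (count_space UNIV) (count_space UNIV) fst snd
    = measure_pmf.expectation W (\<lambda>w. measure_pmf.expectation (V w)
        (\<lambda>z. log 2 (pmf (V w) z) - log 2 (pmf (bind_pmf W V) z)))"
proof -
  define q where "q = channel_joint W V"
  define p where "p = bind_pmf W V"
  interpret information_space "measure_pmf q" 2 by standard simp
  have prod: "count_space (UNIV :: 'w set) \<Otimes>\<^sub>M count_space (UNIV :: 'c set) = count_space UNIV"
    by (subst pair_measure_countable) auto
  interpret P: pair_sigma_finite "count_space (UNIV :: 'w set)" "count_space (UNIV :: 'c set)"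
    by (intro pair_sigma_finite.intro sigma_finite_measure_count_space)
  define f where "f w z = pmf q (w, z) * log 2 (pmf q (w, z) / (pmf W w * pmf p z))" for w z
  \<comment> \<open>Where \<open>q\<close> vanishes, one of the factors \<open>pmf W w\<close> and
    \<open>pmf (V w) z\<close> is zero, and both sides are 0 whatever the logarithms are.\<close>
  have f: "f w z = pmf W w * (pmf (V w) z * (log 2 (pmf (V w) z) - log 2 (pmf p z)))" for w z
  proof (cases "pmf q (w, z) = 0")
    case False
    then have ne: "w \<in> set_pmf W" "z \<in> set_pmf (V w)"
      by (simp_all add: q_def pmf_channel_joint set_pmf_iff)
    then have "0 < pmf W w" "0 < pmf (V w) z" by (simp_all add: pmf_positive)
    moreover have "z \<in> set_pmf p" using ne by (auto simp: p_def)
    then have "0 < pmf p z" by (rule pmf_positive)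
    ultimately show ?thesis by (simp add: f_def q_def pmf_channel_joint log_divide)
  qed (auto simp: f_def q_def pmf_channel_joint)
  note MI_formula = mutual_information_distr[where S = "count_space UNIV" and T = "count_space UNIV"
      and X = fst and Y = snd and Px = "pmf W" and Py = "pmf p" and Pxy = "pmf q"]
  have MI: "prob_space.mutual_information q 2 (count_space UNIV) (count_space UNIV) fst snd
      = integral\<^sup>L (count_space UNIV \<Otimes>\<^sub>M count_space UNIV) (\<lambda>x. f (fst x) (snd x))"
      unfolding f_def prod.collapse
  proof (rule MI_formula)
    show "distributed (measure_pmf q) (count_space UNIV) fst (\<lambda>x. ennreal (pmf W x))"
      using distributed_pmf[of q fst] by (simp add: q_def map_fst_channel_joint)
    show "distributed (measure_pmf q) (count_space UNIV) snd (\<lambda>x. ennreal (pmf p x))"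
      using distributed_pmf[of q snd] by (simp add: q_def p_def map_snd_channel_joint)
    show "distributed (measure_pmf q) (count_space UNIV \<Otimes>\<^sub>M count_space UNIV) (\<lambda>x. (fst x, snd x))
        (\<lambda>x. ennreal (pmf q x))"
      using distributed_pmf[of q "\<lambda>x. x"] by (simp add: prod)
  qed (auto simp: f_def sigma_finite_measure_count_space)
  define C where "C = (\<Sum>z\<in>UNIV. \<bar>log 2 (pmf p z)\<bar>)"
  have C: "\<bar>log 2 (pmf p z)\<bar> \<le> C" for z
    unfolding C_def by (rule member_le_sum) auto
  have bound: "\<bar>f w z\<bar> \<le> (1 / ln 2 + C) * pmf W w" for w z
  proof -
    have "\<bar>pmf (V w) z * (log 2 (pmf (V w) z) - log 2 (pmf p z))\<bar>
        \<le> \<bar>eta (pmf (V w) z)\<bar> + pmf (V w) z * \<bar>log 2 (pmf p z)\<bar>"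
      using abs_triangle_ineq[of "- eta (pmf (V w) z)" "- (pmf (V w) z * log 2 (pmf p z))"]
      by (simp add: eta_def algebra_simps abs_mult)
    also have "\<dots> \<le> 1 / ln 2 + C"
      using eta_nonneg[of "pmf (V w) z"] eta_le[of "pmf (V w) z"] C[of z]
        mult_left_le_one_le[of "\<bar>log 2 (pmf p z)\<bar>" "pmf (V w) z"] by (simp add: pmf_le_1)
    finally show ?thesis
      by (simp add: f abs_mult mult.commute mult_left_mono)
  qed
  have int: "integrable (count_space UNIV \<Otimes>\<^sub>M count_space UNIV) (\<lambda>(w, z). f w z)"
    unfolding prod
  proof (rule Bochner_Integration.integrable_bound)
    \<comment> \<open>The bound on \<open>f w z\<close> is constant in \<open>z\<close>, so it is a
      multiple of the mass of \<open>W\<close> paired with a uniform symbol, and a pmf is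
      integrable.\<close>
    let ?U = "pair_pmf W (pmf_of_set (UNIV :: 'c set))"
    show "integrable (count_space UNIV) (\<lambda>x. (1 / ln 2 + C) * real CARD('c) * pmf ?U x)"
      by (intro integrable_mult_right integrable_pmf)
    show "AE x in count_space UNIV. norm (case x of (w, z) \<Rightarrow> f w z)
        \<le> norm ((1 / ln 2 + C) * real CARD('c) * pmf ?U x)"
      using bound by (auto simp: pmf_pair AE_count_space intro: order.trans[OF _ abs_ge_self])
  qed simp
  have "prob_space.mutual_information q 2 (count_space UNIV) (count_space UNIV) fst snd
      = (\<integral>w. (\<integral>z. f w z \<partial>count_space UNIV) \<partial>count_space UNIV)"
    unfolding MI using P.integral_fst[OF int] by (simp add: case_prod_beta')
  also have "\<dots> = (\<integral>w. pmf W w * measure_pmf.expectation (V w)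
      (\<lambda>z. log 2 (pmf (V w) z) - log 2 (pmf p z)) \<partial>count_space UNIV)"
    by (simp add: lebesgue_integral_count_space_finite f expectation_finite_type sum_distrib_left)
  also have "\<dots> = measure_pmf.expectation W (\<lambda>w. measure_pmf.expectation (V w)
      (\<lambda>z. log 2 (pmf (V w) z) - log 2 (pmf p z)))"
    by (simp add: measure_pmf_eq_density[of W] integral_density)
  finally show ?thesis by (simp add: q_def p_def)
qed

text \<open>Independence given \<open>w\<close> splits the conditional entropy, and the term in
  \<open>log 2 (pmf p z)\<close> averages to \<open>pmf_entropy p\<close> for every decomposition.
  Minimising information is therefore maximising the mean of
  \<open>pmf_entropy (A w) + pmf_entropy (B w)\<close>.\<close>

lemma mutual_information_product_channel:
  fixes W :: "'w::countable pmf" and A :: "'w \<Rightarrow> 'a::finite pmf" and B :: "'w \<Rightarrow> 'b::finite pmf"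
  assumes p: "bind_pmf W (\<lambda>w. pair_pmf (A w) (B w)) = p"
  shows "prob_space.mutual_information (channel_joint W (\<lambda>w. pair_pmf (A w) (B w))) 2
      (count_space UNIV) (count_space UNIV) fst snd
    = pmf_entropy p - measure_pmf.expectation W (\<lambda>w. pmf_entropy (A w) + pmf_entropy (B w))"
proof -
  let ?V = "\<lambda>w. pair_pmf (A w) (B w)"
  have "measure_pmf.expectation (?V w) (\<lambda>z. log 2 (pmf (?V w) z) - log 2 (pmf p z))
      = measure_pmf.expectation (?V w) (\<lambda>z. - log 2 (pmf p z)) - (pmf_entropy (A w) + pmf_entropy (B w))" for w
    using pmf_entropy_pair[of "A w" "B w", unfolded pmf_entropy_def[of "pair_pmf _ _"]]
    by (simp add: expectation_finite_type sum_subtractf sum_negf algebra_simps)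
  then have "prob_space.mutual_information (channel_joint W ?V) 2 (count_space UNIV) (count_space UNIV) fst snd
      = measure_pmf.expectation W (\<lambda>w. measure_pmf.expectation (?V w) (\<lambda>z. - log 2 (pmf p z))
          - (pmf_entropy (A w) + pmf_entropy (B w)))"
    by (simp add: mutual_information_channel_joint p)
  also have "\<dots> = measure_pmf.expectation W (\<lambda>w. measure_pmf.expectation (?V w) (\<lambda>z. - log 2 (pmf p z)))
      - measure_pmf.expectation W (\<lambda>w. pmf_entropy (A w) + pmf_entropy (B w))"
    by (intro Bochner_Integration.integral_diff Bochner_Integration.integrable_add integrable_expectation_finite_type integrable_pmf_entropy)
  also have "measure_pmf.expectation W (\<lambda>w. measure_pmf.expectation (?V w) (\<lambda>z. - log 2 (pmf p z)))
      = pmf_entropy p"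
    unfolding pmf_entropy_def
    by (subst expectation_bind_finite_type[symmetric]) (simp add: p)
  finally show ?thesis .
qed

section \<open>Wyner common information as a concave envelope\<close>

text \<open>Places laws in a Euclidean space, the setting for compactness, convex hulls and
  separating hyperplanes.\<close>

definition pmf_vec :: "'c::finite pmf \<Rightarrow> real ^ 'c" where
  "pmf_vec P = (\<chi> x. pmf P x)"

lemma pmf_vec_nth [simp]: "pmf_vec P $ x = pmf P x"
  by (simp add: pmf_vec_def)

lemma pmf_embed_finite_type:
  fixes v :: "'c::finite \<Rightarrow> real"
  assumes "\<And>x. 0 \<le> v x" "(\<Sum>x\<in>UNIV. v x) = 1"
  shows "pmf (embed_pmf v) x = v x"
  using assms by (intro pmf_embed_pmf) (simp_all add: nn_integral_count_space_finite sum_ennreal)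

lemma range_pmf_vec: "range (pmf_vec :: 'c::finite pmf \<Rightarrow> _) = {v. (\<forall>x. 0 \<le> v $ x) \<and> (\<Sum>x\<in>UNIV. v $ x) = 1}"
proof (intro equalityI subsetI)
  fix v :: "real ^ 'c" assume "v \<in> {v. (\<forall>x. 0 \<le> v $ x) \<and> (\<Sum>x\<in>UNIV. v $ x) = 1}"
  then have "v = pmf_vec (embed_pmf (\<lambda>x. v $ x))"
    by (simp add: vec_eq_iff pmf_embed_finite_type)
  then show "v \<in> range pmf_vec" by blast
qed (auto simp: sum_pmf_eq_1)

lemma compact_range_pmf_vec: "compact (range (pmf_vec :: 'c::finite pmf \<Rightarrow> _))"
proof -
  have "bounded (range (pmf_vec :: 'c pmf \<Rightarrow> _))"
    unfolding bounded_iff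
  proof (intro exI ballI)
    fix v :: "real ^ 'c" assume "v \<in> range pmf_vec"
    then show "norm v \<le> 1"
      using norm_le_l1_cart[of v] by (auto simp: sum_pmf_eq_1)
  qed
  moreover have "closed (range (pmf_vec :: 'c pmf \<Rightarrow> _))"
    unfolding range_pmf_vec
    by (intro closed_Collect_conj closed_Collect_all closed_Collect_le closed_Collect_eq continuous_intros)
  ultimately show ?thesis by (simp add: compact_eq_bounded_closed)
qed

definition product_point :: "'a::finite pmf \<times> 'b::finite pmf \<Rightarrow> (real ^ ('a \<times> 'b)) \<times> real" where
  "product_point AB = (pmf_vec (pair_pmf (fst AB) (snd AB)), pmf_entropy (fst AB) + pmf_entropy (snd AB))"

text \<open>The continuous image of a product of two simplices; \<open>f\<close> rewrites the point
  in vector coordinates.\<close>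

lemma compact_range_product_point: "compact (range (product_point :: 'a::finite pmf \<times> 'b::finite pmf \<Rightarrow> _))"
proof -
  define f :: "(real ^ 'a) \<times> (real ^ 'b) \<Rightarrow> (real ^ ('a \<times> 'b)) \<times> real" where
    "f = (\<lambda>(u, v). (\<chi> z. u $ fst z * v $ snd z, (\<Sum>x\<in>UNIV. eta (u $ x)) + (\<Sum>y\<in>UNIV. eta (v $ y))))"
  have "product_point (A, B) = f (pmf_vec A, pmf_vec B)" for A :: "'a pmf" and B :: "'b pmf"
    by (auto simp: product_point_def f_def pmf_entropy_eq_sum_eta vec_eq_iff pmf_pair)
  then have "y \<in> range product_point \<longleftrightarrow> (\<exists>A B. y = f (pmf_vec A, pmf_vec B))" for y
    by (metis rangeE rangeI prod.collapse)
  then have "range product_point = f ` (range pmf_vec \<times> range pmf_vec)"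
    unfolding set_eq_iff image_iff by blast
  moreover have "continuous_on (range pmf_vec \<times> range pmf_vec) f"
  proof -
    have "continuous_on (range pmf_vec \<times> range pmf_vec) (\<lambda>w :: (real ^ 'a) \<times> (real ^ 'b). eta (fst w $ x))"
      and "continuous_on (range pmf_vec \<times> range pmf_vec) (\<lambda>w :: (real ^ 'a) \<times> (real ^ 'b). eta (snd w $ y))" for x y
      by (rule continuous_on_compose2[OF continuous_on_eta]; force intro!: continuous_intros)+
    then show ?thesis
      unfolding f_def case_prod_beta' by (intro continuous_intros) auto
  qed
  ultimately show ?thesis
    by (metis compact_continuous_image compact_Times compact_range_pmf_vec)
qed

lemma convex_hull_mixtureE:
  fixes S :: "'a::real_vector set"
  assumes "y \<in> convex hull S"
  obtains W :: "nat pmf" and x :: "nat \<Rightarrow> 'a"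
  where "y = (\<Sum>i\<in>set_pmf W. pmf W i *\<^sub>R x i)" "finite (set_pmf W)" "\<And>i. i \<in> set_pmf W \<Longrightarrow> x i \<in> S"
proof -
  have "\<exists>k u x. (\<forall>i\<in>{1::nat..k}. 0 \<le> u i \<and> x i \<in> S) \<and> (sum u {1..k} = 1) \<and> (\<Sum>i = 1..k. u i *\<^sub>R x i) = y"
    using assms unfolding convex_hull_indexed mem_Collect_eq .
  then show thesis
  proof (elim exE conjE)
    fix k u x
    assume u: "\<forall>i\<in>{1::nat..k}. 0 \<le> u i \<and> x i \<in> S" "sum u {1..k} = 1" and y: "(\<Sum>i = 1..k. u i *\<^sub>R x i) = y"
    define v where "v i = (if i \<in> {1..k} then u i else 0)" for i
    have "(\<integral>\<^sup>+ i. ennreal (v i) \<partial>count_space UNIV) = (\<Sum>i\<in>{1..k}. ennreal (v i))"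
      by (rule nn_integral_count_space'[of "{1..k}"]) (auto simp: v_def)
    also have "\<dots> = ennreal (\<Sum>i\<in>{1..k}. u i)"
      using u(1) by (subst sum_ennreal[symmetric]) (auto simp: v_def intro!: sum.cong)
    also have "\<dots> = 1" using u(2) by simp
    finally have pmf: "pmf (embed_pmf v) i = v i" for i
      using u by (intro pmf_embed_pmf) (auto simp: v_def)
    then have sub: "set_pmf (embed_pmf v) \<subseteq> {1..k}"
      by (auto simp: set_pmf_iff v_def split: if_splits)
    have "y = (\<Sum>i = 1..k. pmf (embed_pmf v) i *\<^sub>R x i)"
      unfolding y[symmetric] by (intro sum.cong) (simp_all add: pmf v_def)
    also have "\<dots> = (\<Sum>i\<in>set_pmf (embed_pmf v). pmf (embed_pmf v) i *\<^sub>R x i)"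
      using sub by (intro sum.mono_neutral_right) (auto simp: set_pmf_iff)
    finally show thesis
      using sub u(1) by (intro that[of "embed_pmf v" x]) (auto intro: finite_subset)
  qed
qed

text \<open>
  The points \<open>(A \<times> B, H(A) + H(B))\<close> form a compact set, so its convex hull is compact and the
  highest point \<open>(p, F)\<close> above \<open>p\<close> is a finite mixture. The function \<open>g\<close> is the affine functional
  of a hyperplane separating the hull from \<open>(p, F + \<epsilon>)\<close>; that hyperplane is not vertical because
  \<open>(p, F)\<close> lies in the hull.
\<close>
lemma product_decomposition_optimal:
  fixes p :: "('a::finite \<times> 'b::finite) pmf"
  obtains W :: "nat pmf" and A :: "nat \<Rightarrow> 'a pmf" and B :: "nat \<Rightarrow> 'b pmf"
  where "finite (set_pmf W)" "bind_pmf W (\<lambda>w. pair_pmf (A w) (B w)) = p"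
    "\<And>\<epsilon>. 0 < \<epsilon> \<Longrightarrow> \<exists>g. (\<forall>A' B'. pmf_entropy A' + pmf_entropy B' \<le> measure_pmf.expectation (pair_pmf A' B') g)
      \<and> measure_pmf.expectation p g \<le> measure_pmf.expectation W (\<lambda>w. pmf_entropy (A w) + pmf_entropy (B w)) + \<epsilon>"
proof -
  define K where "K = convex hull (range (product_point :: 'a pmf \<times> 'b pmf \<Rightarrow> _))"
  have K: "compact K" "convex K"
    by (simp_all add: K_def compact_convex_hull compact_range_product_point convex_convex_hull)
  let ?T = "snd ` (K \<inter> {pmf_vec p} \<times> UNIV)"
  have "compact ?T"
    using K by (intro compact_continuous_image compact_Int_closed closed_Times continuous_intros) auto
  \<comment> \<open>Decomposing \<open>p\<close> into its point masses, each a product law of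
    entropy 0, shows that the fibre over \<open>p\<close> is nonempty.\<close>
  moreover have "(pmf_vec p, 0) \<in> K"
  proof -
    have "product_point (return_pmf (fst z), return_pmf (snd z)) = (axis z 1, 0)" for z :: "'a \<times> 'b"
      by (auto simp: product_point_def vec_eq_iff axis_def pmf_entropy_def)
    then have "(axis z 1, 0) \<in> K" for z
      unfolding K_def by (metis hull_inc rangeI)
    then have "(\<Sum>z\<in>UNIV. pmf p z *\<^sub>R (axis z 1, 0)) \<in> K"
      using K by (intro convex_sum) (auto simp: sum_pmf_eq_1)
    moreover have "(\<Sum>z\<in>UNIV. pmf p z *\<^sub>R (axis z 1, 0)) = (pmf_vec p, 0 :: real)"
      by (intro prod_eqI)
        (simp_all add: fst_sum snd_sum vec_eq_iff axis_def if_distrib cong: if_cong del: split_paired_All)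
    ultimately show ?thesis by simp
  qed
  then have "?T \<noteq> {}" by force
  ultimately obtain F where "F \<in> ?T" and F_max: "\<And>t. t \<in> ?T \<Longrightarrow> t \<le> F"
    using compact_attains_sup by metis
  then have F: "(pmf_vec p, F) \<in> K" by auto
  obtain W :: "nat pmf" and x where mix: "(pmf_vec p, F) = (\<Sum>i\<in>set_pmf W. pmf W i *\<^sub>R x i)" and fin: "finite (set_pmf W)"
    and x: "\<And>i. i \<in> set_pmf W \<Longrightarrow> x i \<in> range (product_point :: 'a pmf \<times> 'b pmf \<Rightarrow> _)"
  proof (rule convex_hull_mixtureE[OF F[unfolded K_def]])
    fix W :: "nat pmf" and x
    assume "(pmf_vec p, F) = (\<Sum>i\<in>set_pmf W. pmf W i *\<^sub>R x i)" "finite (set_pmf W)"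
      "\<And>i. i \<in> set_pmf W \<Longrightarrow> x i \<in> range (product_point :: 'a pmf \<times> 'b pmf \<Rightarrow> _)"
    then show thesis by (rule that)
  qed
  define AB where "AB i = (SOME ab. x i = product_point ab)" for i
  have AB: "x i = product_point (AB i)" if "i \<in> set_pmf W" for i
  proof -
    have "\<exists>ab. x i = product_point ab" using x[OF that] by blast
    then show ?thesis unfolding AB_def by (rule someI_ex)
  qed
  define A B where "A = fst \<circ> AB" and "B = snd \<circ> AB"
  have E: "measure_pmf.expectation W f = (\<Sum>i\<in>set_pmf W. pmf W i * f i)" for f :: "nat \<Rightarrow> real"
    by (simp add: integral_measure_pmf[OF fin])
  have F_eq: "measure_pmf.expectation W (\<lambda>w. pmf_entropy (A w) + pmf_entropy (B w)) = F"
    using arg_cong[OF mix, of snd] AB by (simp add: E snd_sum product_point_def A_def B_def)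
  have "pmf (bind_pmf W (\<lambda>w. pair_pmf (A w) (B w))) z = pmf p z" for z
    using arg_cong[OF mix, of "\<lambda>y. fst y $ z"] AB
    by (simp add: pmf_bind E fst_sum sum_component product_point_def A_def B_def)
  then have p: "bind_pmf W (\<lambda>w. pair_pmf (A w) (B w)) = p" by (rule pmf_eqI)
  show ?thesis
  proof (rule that[OF fin p], unfold F_eq)
    fix \<epsilon> :: real assume \<epsilon>: "0 < \<epsilon>"
    have "(pmf_vec p, F + \<epsilon>) \<notin> K"
      using F_max[of "F + \<epsilon>"] \<epsilon> by force
    then obtain a b where ab: "inner a (pmf_vec p, F + \<epsilon>) < b" "\<And>y. y \<in> K \<Longrightarrow> b < inner a y"
      using separating_hyperplane_closed_point[OF K(2) compact_imp_closed[OF K(1)]] by blast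
    obtain v c where a: "a = (v, c)" by (cases a)
    have "c * \<epsilon> < 0"
      using ab(1) ab(2)[OF F] by (simp add: a algebra_simps)
    then have c: "c < 0" using \<epsilon> by (simp add: mult_less_0_iff)
    \<comment> \<open>Dividing by \<open>- c > 0\<close> solves the separating inequality for the
      entropy coordinate; the constant \<open>b\<close> is absorbed into \<open>g\<close> because
      masses sum to 1.\<close>
    define g where "g z = (v $ z - b) / (- c)" for z
    have g: "measure_pmf.expectation P g = (inner v (pmf_vec P) - b) / (- c)" for P
    proof -
      have "measure_pmf.expectation P g = (\<Sum>x\<in>UNIV. (v $ x * pmf P x - b * pmf P x) / (- c))"
        by (simp add: expectation_finite_type g_def algebra_simps)
      also have "\<dots> = ((\<Sum>x\<in>UNIV. v $ x * pmf P x) - b * (\<Sum>x\<in>UNIV. pmf P x)) / (- c)"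
        by (simp only: sum_divide_distrib[symmetric] sum_subtractf sum_distrib_left)
      finally show ?thesis by (simp add: inner_vec_def sum_pmf_eq_1)
    qed
    have "pmf_entropy A' + pmf_entropy B' \<le> measure_pmf.expectation (pair_pmf A' B') g" for A' B'
    proof -
      have "product_point (A', B') \<in> K" by (simp add: K_def hull_inc)
      from ab(2)[OF this] show ?thesis
        using c unfolding g by (simp add: a product_point_def field_simps)
    qed
    moreover have "measure_pmf.expectation p g \<le> F + \<epsilon>"
      using ab(1) c unfolding g by (simp add: a field_simps)
    ultimately show "\<exists>g. (\<forall>A' B'. pmf_entropy A' + pmf_entropy B' \<le> measure_pmf.expectation (pair_pmf A' B') g)
        \<and> measure_pmf.expectation p g \<le> F + \<epsilon>" by blast
  qed
qed

lemma markov_chain_channel_joint: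
  fixes A :: "'w \<Rightarrow> 'a::finite pmf" and B :: "'w \<Rightarrow> 'b::finite pmf"
  shows "markov_chain (channel_joint W (\<lambda>w. pair_pmf (A w) (B w))) (fst \<circ> snd) fst (snd \<circ> snd)"
proof -
  let ?q = "channel_joint W (\<lambda>w. pair_pmf (A w) (B w))"
  have prob: "measure_pmf.prob ?q {s. s \<in> S \<and> fst s = w} = pmf W w * measure_pmf.prob (pair_pmf (A w) (B w)) (Pair w -` S)" for S w
  proof -
    have "{s. s \<in> S \<and> fst s = w} = Pair w ` (Pair w -` S)" by auto
    then have "measure_pmf.prob ?q {s. s \<in> S \<and> fst s = w} = (\<Sum>s\<in>Pair w ` (Pair w -` S). pmf ?q s)"
      by (simp add: measure_measure_pmf_finite)
    also have "\<dots> = (\<Sum>z\<in>Pair w -` S. pmf W w * pmf (pair_pmf (A w) (B w)) z)"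
      by (subst sum.reindex) (simp_all add: inj_on_def pmf_channel_joint del: image_vimage_eq)
    also have "\<dots> = pmf W w * measure_pmf.prob (pair_pmf (A w) (B w)) (Pair w -` S)"
      by (simp add: measure_measure_pmf_finite sum_distrib_left)
    finally show ?thesis .
  qed
  have X: "measure_pmf.prob (pair_pmf A' B') {z. fst z = x} = pmf A' x"
    and Y: "measure_pmf.prob (pair_pmf A' B') {z. snd z = y} = pmf B' y"
    and XY: "measure_pmf.prob (pair_pmf A' B') {z. fst z = x \<and> snd z = y} = pmf A' x * pmf B' y"
    for A' :: "'a pmf" and B' :: "'b pmf" and x y
  proof -
    have "pmf A' x = pmf (map_pmf fst (pair_pmf A' B')) x" "pmf B' y = pmf (map_pmf snd (pair_pmf A' B')) y"
      by (simp_all add: map_fst_pair_pmf map_snd_pair_pmf)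
    then show "measure_pmf.prob (pair_pmf A' B') {z. fst z = x} = pmf A' x"
      "measure_pmf.prob (pair_pmf A' B') {z. snd z = y} = pmf B' y"
      by (simp_all add: pmf_map vimage_def)
    have "{z. fst z = x \<and> snd z = y} = {(x, y)}" by auto
    then show "measure_pmf.prob (pair_pmf A' B') {z. fst z = x \<and> snd z = y} = pmf A' x * pmf B' y"
      by (simp add: measure_pmf_single pmf_pair)
  qed
  have W: "measure_pmf.prob ?q {s. fst s = w} = pmf W w" for w
    using prob[of UNIV w] by simp
  show ?thesis
    unfolding markov_chain_def cond_prob_def
  proof (intro ballI allI)
    fix w x y assume "w \<in> fst ` set_pmf ?q"
    then have "pmf W w \<noteq> 0"
      by (metis map_fst_channel_joint set_map_pmf set_pmf_iff)
    then show "\<P>(s in ?q. ((fst \<circ> snd) s = x \<and> (snd \<circ> snd) s = y) \<and> fst s = w) / \<P>(s in ?q. fst s = w) =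
        (\<P>(s in ?q. (fst \<circ> snd) s = x \<and> fst s = w) / \<P>(s in ?q. fst s = w)) *
        (\<P>(s in ?q. (snd \<circ> snd) s = y \<and> fst s = w) / \<P>(s in ?q. fst s = w))"
      using prob[of "{s. fst (snd s) = x \<and> snd (snd s) = y}" w] prob[of "{s. fst (snd s) = x}" w]
        prob[of "{s. snd (snd s) = y}" w]
      by (simp add: W X Y XY)
  qed
qed

text \<open>\<open>A w\<close> and \<open>B w\<close> are the conditional laws of the two components
  given \<open>w\<close>; the Markov property says that the conditional joint law is their
  product.\<close>

lemma markov_chain_imp_channel_joint:
  fixes q :: "('w \<times> 'a \<times> 'b) pmf"
  assumes "markov_chain q (fst \<circ> snd) fst (snd \<circ> snd)"
  obtains A B where "q = channel_joint (map_pmf fst q) (\<lambda>w. pair_pmf (A w) (B w))"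
proof
  define D where "D w = cond_pmf q (fst -` {w})" for w
  define A where "A w = map_pmf (fst \<circ> snd) (D w)" for w
  define B where "B w = map_pmf (snd \<circ> snd) (D w)" for w
  show "q = channel_joint (map_pmf fst q) (\<lambda>w. pair_pmf (A w) (B w))"
  proof (rule pmf_eqI)
    fix s :: "'w \<times> 'a \<times> 'b"
    obtain w x y where s: "s = (w, x, y)" by (metis prod.collapse)
    have W: "pmf (map_pmf fst q) w = measure_pmf.prob q {s. fst s = w}"
      by (simp add: pmf_map vimage_def)
    show "pmf q s = pmf (channel_joint (map_pmf fst q) (\<lambda>w. pair_pmf (A w) (B w))) s"
    proof (cases "w \<in> fst ` set_pmf q")
      case True
      then have ne: "set_pmf q \<inter> fst -` {w} \<noteq> {}" by auto
      have D: "measure_pmf.prob (D w) T = measure_pmf.prob q (fst -` {w} \<inter> T) / measure_pmf.prob q (fst -` {w})" for T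
        unfolding D_def cond_pmf.rep_eq[OF ne]
        by (rule measure_uniform_measure) (use emeasure_measure_pmf_not_zero[OF ne] in auto)
      have cond: "measure_pmf.prob (D w) {s. P s} = \<P>(s in q. P s \<bar> fst s = w)" for P
        by (simp add: cond_prob_def D vimage_def Int_def conj_commute)
      have A: "pmf (A w) x = \<P>(s in q. (fst \<circ> snd) s = x \<bar> fst s = w)"
        and B: "pmf (B w) y = \<P>(s in q. (snd \<circ> snd) s = y \<bar> fst s = w)"
        using cond by (simp_all add: A_def B_def pmf_map vimage_def)
      have "pmf q s = \<P>(s in q. ((fst \<circ> snd) s = x \<and> (snd \<circ> snd) s = y) \<and> fst s = w)"
        by (simp add: s pmf.rep_eq) (rule arg_cong[where f = "measure_pmf.prob q"], auto)
      also have "\<dots> = pmf (map_pmf fst q) w * \<P>(s in q. (fst \<circ> snd) s = x \<and> (snd \<circ> snd) s = y \<bar> fst s = w)"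
        using True by (auto simp: cond_prob_def W measure_pmf_zero_iff vimage_def)
      also have "\<P>(s in q. (fst \<circ> snd) s = x \<and> (snd \<circ> snd) s = y \<bar> fst s = w) = pmf (A w) x * pmf (B w) y"
        using assms True unfolding markov_chain_def A B by blast
      finally show ?thesis by (simp add: s pmf_channel_joint pmf_pair)
    next
      \<comment> \<open>Off the support of the first marginal the conditional law \<open>D w\<close>
        is unspecified, but it carries weight 0.\<close>
      case False
      then have "pmf q s = 0" by (force simp: s pmf_eq_0_set_pmf)
      moreover have "pmf (map_pmf fst q) w = 0" using False by (simp add: pmf_eq_0_set_pmf)
      ultimately show ?thesis by (simp add: s pmf_channel_joint)
    qed
  qed
qed

text \<open>The minimum is attained by the optimal finite decomposition. A competitor
  \<open>q\<close> may involve infinitely many values of \<open>w\<close>; averaging the affine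
  bound \<open>g\<close> over them still works, since the resulting mean of \<open>g\<close> depends
  only on the marginal \<open>p\<close>. The same \<open>g\<close> is passed on to the
  converse.\<close>

lemma wyner_common_information_characterization:
  fixes p :: "('a::finite \<times> 'b::finite) pmf"
  obtains W :: "nat pmf" and A :: "nat \<Rightarrow> 'a pmf" and B :: "nat \<Rightarrow> 'b pmf"
  where "finite (set_pmf W)" "bind_pmf W (\<lambda>w. pair_pmf (A w) (B w)) = p"
    "wyner_common_information p
      = pmf_entropy p - measure_pmf.expectation W (\<lambda>w. pmf_entropy (A w) + pmf_entropy (B w))"
    "\<And>\<epsilon>. 0 < \<epsilon> \<Longrightarrow> \<exists>g. (\<forall>A' B'. pmf_entropy A' + pmf_entropy B' \<le> measure_pmf.expectation (pair_pmf A' B') g)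
      \<and> measure_pmf.expectation p g \<le> pmf_entropy p - wyner_common_information p + \<epsilon>"
proof (rule product_decomposition_optimal[of p])
  fix W :: "nat pmf" and A :: "nat \<Rightarrow> 'a pmf" and B :: "nat \<Rightarrow> 'b pmf"
  assume fin: "finite (set_pmf W)" and p: "bind_pmf W (\<lambda>w. pair_pmf (A w) (B w)) = p"
    and g: "\<And>\<epsilon>. 0 < \<epsilon> \<Longrightarrow> \<exists>g. (\<forall>A' B'. pmf_entropy A' + pmf_entropy B' \<le> measure_pmf.expectation (pair_pmf A' B') g)
      \<and> measure_pmf.expectation p g \<le> measure_pmf.expectation W (\<lambda>w. pmf_entropy (A w) + pmf_entropy (B w)) + \<epsilon>"
  let ?F = "measure_pmf.expectation W (\<lambda>w. pmf_entropy (A w) + pmf_entropy (B w))"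
  have J: "wyner_common_information p = pmf_entropy p - ?F"
    unfolding wyner_common_information_def
  proof (rule Least_equality)
    let ?q = "channel_joint W (\<lambda>w. pair_pmf (A w) (B w))"
    have "map_pmf snd ?q = p" by (simp add: map_snd_channel_joint p)
    then show "\<exists>q :: (nat \<times> 'a \<times> 'b) pmf. map_pmf snd q = p \<and> markov_chain q (fst \<circ> snd) fst (snd \<circ> snd) \<and>
        pmf_entropy p - ?F = prob_space.mutual_information q 2 (count_space UNIV) (count_space UNIV) fst snd"
      by (intro exI[of _ ?q] conjI markov_chain_channel_joint mutual_information_product_channel[OF p, symmetric])
  next
    fix v assume "\<exists>q :: (nat \<times> 'a \<times> 'b) pmf. map_pmf snd q = p \<and> markov_chain q (fst \<circ> snd) fst (snd \<circ> snd) \<and>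
        v = prob_space.mutual_information q 2 (count_space UNIV) (count_space UNIV) fst snd"
    then obtain q :: "(nat \<times> 'a \<times> 'b) pmf" where q: "map_pmf snd q = p" "markov_chain q (fst \<circ> snd) fst (snd \<circ> snd)"
      and v: "v = prob_space.mutual_information q 2 (count_space UNIV) (count_space UNIV) fst snd" by blast
    obtain A' B' where q_eq: "q = channel_joint (map_pmf fst q) (\<lambda>w. pair_pmf (A' w) (B' w))"
      using markov_chain_imp_channel_joint[OF q(2)] by blast
    let ?W = "map_pmf fst q"
    have p': "bind_pmf ?W (\<lambda>w. pair_pmf (A' w) (B' w)) = p"
      using q(1) by (subst map_snd_channel_joint[symmetric]) (simp only: q_eq[symmetric])
    have v_eq: "v = pmf_entropy p - measure_pmf.expectation ?W (\<lambda>w. pmf_entropy (A' w) + pmf_entropy (B' w))"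
      using mutual_information_product_channel[OF p'] by (simp add: v q_eq[symmetric])
    show "pmf_entropy p - ?F \<le> v"
    proof (rule field_le_epsilon)
      fix \<epsilon> :: real assume "0 < \<epsilon>"
      then obtain g where g: "\<forall>A' B'. pmf_entropy A' + pmf_entropy B' \<le> measure_pmf.expectation (pair_pmf A' B') g"
        "measure_pmf.expectation p g \<le> ?F + \<epsilon>" using g by blast
      have "measure_pmf.expectation ?W (\<lambda>w. pmf_entropy (A' w) + pmf_entropy (B' w))
          \<le> measure_pmf.expectation ?W (\<lambda>w. measure_pmf.expectation (pair_pmf (A' w) (B' w)) g)"
        using g(1) by (intro integral_mono Bochner_Integration.integrable_add integrable_pmf_entropy
            integrable_expectation_finite_type) auto
      also have "\<dots> = measure_pmf.expectation p g"
        by (subst expectation_bind_finite_type[symmetric]) (simp only: p')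
      finally show "pmf_entropy p - ?F \<le> v + \<epsilon>" using g(2) v_eq by simp
    qed
  qed
  then have "?F = pmf_entropy p - wyner_common_information p" by simp
  then show thesis using g by (intro that[OF fin p J]) simp
qed

section \<open>Converse\<close>

lemma finite_lists_length: "finite {xs :: 'a::finite list. length xs = n}"
  using finite_lists_length_eq[of "UNIV :: 'a set" n] by simp

lemma card_bool_lists_length: "card {u :: bool list. length u = j} = 2 ^ j"
  using card_lists_length_eq[of "UNIV :: bool set" j] by simp

text \<open>Each codeword owns \<open>2 ^ (N - length u)\<close> extensions to the common length
  \<open>N\<close>; prefix-freeness makes these sets disjoint inside the \<open>2 ^ N\<close>
  words.\<close>

lemma kraft_finite:
  fixes S :: "bool list set"
  assumes fin: "finite S" and pf: "\<And>u v. u \<in> S \<Longrightarrow> v \<in> S \<Longrightarrow> prefix u v \<Longrightarrow> u = v"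
  shows "(\<Sum>u\<in>S. (1 / 2 :: real) ^ length u) \<le> 1"
proof -
  \<comment> \<open>The sum of the lengths is a common upper bound that also makes sense for empty
    \<open>S\<close>.\<close>
  define N where "N = (\<Sum>u\<in>S. length u)"
  have N: "length u \<le> N" if "u \<in> S" for u
    unfolding N_def using that fin by (intro member_le_sum) auto
  define E where "E u = {v :: bool list. length v = N \<and> prefix u v}" for u
  have card_E: "card (E u) = 2 ^ (N - length u)" if "u \<in> S" for u
  proof -
    have "E u = (\<lambda>w. u @ w) ` {w. length w = N - length u}"
      using N[OF that] by (auto simp: E_def prefix_def)
    then show ?thesis by (simp add: card_image inj_on_def card_bool_lists_length)
  qed
  have "(\<Sum>u\<in>S. card (E u)) = card (\<Union>u\<in>S. E u)"
  proof (rule card_UN_disjoint[symmetric])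
    show "\<forall>u\<in>S. finite (E u)" by (auto simp: E_def intro: finite_subset[OF _ finite_lists_length])
    show "\<forall>u\<in>S. \<forall>v\<in>S. u \<noteq> v \<longrightarrow> E u \<inter> E v = {}"
      using pf by (auto simp: E_def) (metis prefix_same_cases)
  qed (rule fin)
  also have "\<dots> \<le> card {v :: bool list. length v = N}"
    by (intro card_mono finite_lists_length) (auto simp: E_def)
  finally have "(\<Sum>u\<in>S. 2 ^ (N - length u)) \<le> (2 ^ N :: nat)"
    by (simp add: card_E card_bool_lists_length)
  then have "real (\<Sum>u\<in>S. 2 ^ (N - length u)) \<le> 2 ^ N"
    by (metis of_nat_le_iff of_nat_numeral of_nat_power)
  moreover have "real (\<Sum>u\<in>S. 2 ^ (N - length u)) = 2 ^ N * (\<Sum>u\<in>S. (1 / 2) ^ length u)"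
  proof -
    have "(2 :: real) ^ (N - length u) = 2 ^ N * (1 / 2) ^ length u" if "u \<in> S" for u
    proof -
      have "(2 :: real) ^ N = 2 ^ (N - length u) * 2 ^ length u"
        using N[OF that] by (simp flip: power_add)
      then show ?thesis by (simp add: power_one_over)
    qed
    then show ?thesis by (simp add: sum_distrib_left)
  qed
  ultimately show ?thesis by simp
qed

text \<open>With \<open>r\<close> the ratio of \<open>(1 / 2) ^ length\<close> to probability,
  Kraft's inequality bounds the mean of \<open>r\<close> by 1, and
  \<open>d - L \<le> log 2 r \<le> (r - 1) / ln 2\<close>. An integrable minorant \<open>d\<close>
  of the self-information allows two uses: a lower bound on the divergence of a decoder output from
  the overall output in the converse, and the leaf lengths of the split tree in its optimality
  proof.\<close>

lemma prefix_code_expectation_le: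
  fixes W :: "nat pmf" and d :: "nat \<Rightarrow> real"
  assumes code: "prefix_free_code W c" and len: "expected_length W c = ennreal l" and l: "0 \<le> l"
    and int_d: "integrable (measure_pmf W) d"
    and d: "\<And>w. w \<in> set_pmf W \<Longrightarrow> d w \<le> - log 2 (pmf W w)"
  shows "measure_pmf.expectation W d \<le> l"
proof -
  define L where "L w = real (length (c w))" for w
  define r where "r w = (1 / 2) ^ length (c w) / pmf W w" for w
  have nn_L: "(\<integral>\<^sup>+ w. ennreal (L w) \<partial>measure_pmf W) = ennreal l"
    using len by (simp add: expected_length_def L_def)
  have int_L: "integrable (measure_pmf W) L"
    using nn_L by (intro integrableI_nn_integral_finite) (auto simp: L_def)
  have E_L: "measure_pmf.expectation W L = l"
    using nn_L l by (simp add: integral_eq_nn_integral L_def)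
  have "(\<integral>\<^sup>+ w. ennreal (r w) \<partial>measure_pmf W) = (\<Sum>w. ennreal (pmf W w * r w))"
    by (simp add: nn_integral_measure_pmf nn_integral_count_space_nat ennreal_mult')
  \<comment> \<open>The support may be infinite, so the finite Kraft inequality is applied to the
    partial sums of the series.\<close>
  also have "\<dots> \<le> 1"
  proof (rule suminf_le_const)
    fix n
    let ?S = "{..<n} \<inter> set_pmf W"
    have sum: "(\<Sum>w<n. ennreal (pmf W w * r w)) = ennreal (\<Sum>w<n. pmf W w * r w)"
      by (intro sum_ennreal) (simp add: r_def)
    have "(\<Sum>w<n. pmf W w * r w) = (\<Sum>w\<in>?S. (1 / 2) ^ length (c w))"
      by (rule sum.mono_neutral_cong_right) (auto simp: r_def set_pmf_iff)
    also have "\<dots> = (\<Sum>u\<in>c ` ?S. (1 / 2) ^ length u)"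
      using code by (subst sum.reindex) (auto simp: prefix_free_code_def intro: inj_on_subset)
    also have "\<dots> \<le> 1"
      using code by (intro kraft_finite) (auto simp: prefix_free_code_def)
    finally show "(\<Sum>w<n. ennreal (pmf W w * r w)) \<le> 1"
      by (simp add: sum ennreal_le_1)
  qed simp
  finally have nn_r: "(\<integral>\<^sup>+ w. ennreal (r w) \<partial>measure_pmf W) \<le> 1" .
  have r_nonneg: "0 \<le> r w" for w by (simp add: r_def)
  have int_r: "integrable (measure_pmf W) r"
    using nn_r r_nonneg by (intro integrableI_bounded) (auto simp: le_less_trans)
  have "ennreal (measure_pmf.expectation W r) \<le> 1"
    using nn_r r_nonneg int_r by (simp add: nn_integral_eq_integral)
  then have E_r: "measure_pmf.expectation W r \<le> 1"
    by (simp add: ennreal_le_1)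
  have "measure_pmf.expectation W (\<lambda>w. d w - L w) \<le> measure_pmf.expectation W (\<lambda>w. (r w - 1) / ln 2)"
  proof (rule integral_mono_AE)
    have "d w - L w \<le> (r w - 1) / ln 2" if w: "w \<in> set_pmf W" for w
    proof -
      have "d w - L w \<le> log 2 (r w)"
        using d[OF w] pmf_positive[OF w]
        by (simp add: r_def L_def log_divide log_nat_power)
      also have "\<dots> \<le> (r w - 1) / ln 2"
        using pmf_positive[OF w] by (intro log2_le_linear) (simp add: r_def)
      finally show ?thesis .
    qed
    then show "AE w in measure_pmf W. d w - L w \<le> (r w - 1) / ln 2"
      by (simp add: AE_measure_pmf_iff)
  qed (use int_d int_L int_r in auto)
  also have "\<dots> = (measure_pmf.expectation W r - 1) / ln 2"
    using int_r by simp
  also have "\<dots> \<le> 0" using E_r by (simp add: divide_nonpos_pos)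
  finally show ?thesis using int_d int_L E_L by simp
qed

section \<open>Single-letter bound for one simulation code\<close>

definition block_pairs :: "nat \<Rightarrow> ('a list \<times> 'b list) set" where
  "block_pairs n = {xs. length xs = n} \<times> {ys. length ys = n}"

lemma finite_block_pairs: "finite (block_pairs n :: ('a::finite list \<times> 'b::finite list) set)"
  by (simp add: block_pairs_def finite_lists_length)

lemma simulation_code_pair_subset:
  assumes "simulation_code W decX decY R n" "w \<in> set_pmf W"
  shows "set_pmf (pair_pmf (decX w) (decY w)) \<subseteq> block_pairs n"
  using assms by (auto simp: simulation_code_def block_pairs_def)

lemma simulation_code_output_subset:
  assumes "simulation_code W decX decY R n"
  shows "set_pmf (code_output W decX decY) \<subseteq> block_pairs n"
  using simulation_code_pair_subset[OF assms] by (fastforce simp: code_output_def)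

definition block_sum :: "('a \<times> 'b \<Rightarrow> real) \<Rightarrow> nat \<Rightarrow> 'a list \<times> 'b list \<Rightarrow> real" where
  "block_sum g n z = (\<Sum>i<n. g (fst z ! i, snd z ! i))"

text \<open>For fixed \<open>w\<close> the mean of \<open>\<phi>\<close> under \<open>V w\<close> is
  at most the divergence of \<open>V w\<close> from the output law \<open>P\<close>:
  \<open>V w\<close> is a product of two block laws, entropy is subadditive over coordinates, and
  \<open>g\<close> bounds each coordinate pair. That divergence is at most
  \<open>- log 2 (pmf W w)\<close>, so the mean of \<open>\<phi>\<close> can serve as the minorant
  \<open>d\<close>.\<close>

lemma simulation_code_rate_ge:
  fixes g :: "'a::finite \<times> 'b::finite \<Rightarrow> real"
  assumes code: "simulation_code W decX decY R n"
    and g: "\<And>A B. pmf_entropy A + pmf_entropy B \<le> measure_pmf.expectation (pair_pmf A B) g"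
  shows "pmf_entropy (code_output W decX decY)
    - measure_pmf.expectation (code_output W decX decY) (block_sum g n) \<le> real n * R"
proof -
  define V where "V w = pair_pmf (decX w) (decY w)" for w
  define P where "P = code_output W decX decY"
  define \<phi> where "\<phi> z = - log 2 (pmf P z) - block_sum g n z" for z
  have P: "P = bind_pmf W V" by (simp add: P_def V_def[abs_def] code_output_def)
  have sub: "set_pmf (V w) \<subseteq> block_pairs n" if "w \<in> set_pmf W" for w
    using simulation_code_pair_subset[OF code that] by (simp add: V_def)
  have subP: "set_pmf P \<subseteq> block_pairs n"
    unfolding P_def by (rule simulation_code_output_subset[OF code])
  have E: "measure_pmf.expectation P \<phi> = measure_pmf.expectation W (\<lambda>w. measure_pmf.expectation (V w) \<phi>)"
    unfolding P using sub by (rule expectation_bind_finite[OF finite_block_pairs])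
  obtain c where c: "prefix_free_code W c" "expected_length W c = ennreal (real n * R)" and nR: "0 \<le> real n * R"
    using code by (auto simp: simulation_code_def is_min_expected_length_def)
  have "measure_pmf.expectation W (\<lambda>w. measure_pmf.expectation (V w) \<phi>) \<le> real n * R"
  proof (rule prefix_code_expectation_le[OF c nR])
    show "integrable (measure_pmf W) (\<lambda>w. measure_pmf.expectation (V w) \<phi>)"
      using sub by (rule integrable_expectation_finite[OF finite_block_pairs])
  next
    fix w assume w: "w \<in> set_pmf W"
    have fin: "finite (set_pmf (V w))" using finite_subset[OF sub[OF w] finite_block_pairs] .
    have int: "integrable (measure_pmf (V w)) f" for f :: "_ \<Rightarrow> real"
      using fin by (rule integrable_measure_pmf_finite)
    have lenX: "\<And>xs. xs \<in> set_pmf (decX w) \<Longrightarrow> length xs = n" and lenY: "\<And>ys. ys \<in> set_pmf (decY w) \<Longrightarrow> length ys = n"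
      using code w by (auto simp: simulation_code_def)
    then have finX: "finite (set_pmf (decX w))" and finY: "finite (set_pmf (decY w))"
      by (auto intro: finite_subset[OF _ finite_lists_length[of n]])
    have "measure_pmf.expectation (V w) (\<lambda>z. - log 2 (pmf (V w) z)) = pmf_entropy (decX w) + pmf_entropy (decY w)"
      unfolding V_def pmf_entropy_def[symmetric] by (rule pmf_entropy_pair[OF finX finY])
    also have "\<dots> \<le> (\<Sum>i<n. pmf_entropy (map_pmf (\<lambda>xs. xs ! i) (decX w))) + (\<Sum>i<n. pmf_entropy (map_pmf (\<lambda>ys. ys ! i) (decY w)))"
      using lenX lenY by (intro add_mono pmf_entropy_list_le finX finY)
    also have "\<dots> \<le> (\<Sum>i<n. measure_pmf.expectation (pair_pmf (map_pmf (\<lambda>xs. xs ! i) (decX w)) (map_pmf (\<lambda>ys. ys ! i) (decY w))) g)"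
      unfolding sum.distrib[symmetric] by (intro sum_mono g)
    also have "\<dots> = (\<Sum>i<n. measure_pmf.expectation (V w) (\<lambda>z. g (fst z ! i, snd z ! i)))"
      by (simp add: V_def map_pair[symmetric] case_prod_beta')
    also have "\<dots> = measure_pmf.expectation (V w) (block_sum g n)"
      unfolding block_sum_def by (rule Bochner_Integration.integral_sum[symmetric]) (rule int)
    finally have "measure_pmf.expectation (V w) \<phi>
        \<le> measure_pmf.expectation (V w) (\<lambda>z. - log 2 (pmf P z)) - measure_pmf.expectation (V w) (\<lambda>z. - log 2 (pmf (V w) z))"
      unfolding \<phi>_def using int by simp
    also have "\<dots> = measure_pmf.expectation (V w) (\<lambda>z. log 2 (pmf (V w) z) - log 2 (pmf P z))"
      using int by simp
    also have "\<dots> \<le> measure_pmf.expectation (V w) (\<lambda>z. - log 2 (pmf W w))"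
    proof (rule expectation_mono_finite[OF fin])
      fix z assume z: "z \<in> set_pmf (V w)"
      \<comment> \<open>One term of a mixture is at most the whole mixture, which bounds the
        log-ratio pointwise.\<close>
      have "pmf W w * pmf (V w) z = measure_pmf.expectation W (\<lambda>v. if v = w then pmf (V w) z else 0)"
        by (subst integral_measure_pmf[of "{w}"]) (auto split: if_splits)
      also have "\<dots> \<le> pmf P z"
        unfolding P pmf_bind
        by (intro integral_mono measure_pmf.integrable_const_bound[where B = 1]) (auto simp: pmf_le_1)
      finally have "log 2 (pmf W w * pmf (V w) z) \<le> log 2 (pmf P z)"
        using pmf_positive[OF w] pmf_positive[OF z] by (intro log_mono) auto
      then show "log 2 (pmf (V w) z) - log 2 (pmf P z) \<le> - log 2 (pmf W w)"
        using pmf_positive[OF w] pmf_positive[OF z] by (simp add: log_mult)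
    qed
    finally show "measure_pmf.expectation (V w) \<phi> \<le> - log 2 (pmf W w)" by simp
  qed
  moreover have "measure_pmf.expectation P \<phi> = pmf_entropy P - measure_pmf.expectation P (block_sum g n)"
    unfolding \<phi>_def pmf_entropy_def
    by (intro Bochner_Integration.integral_diff integrable_measure_pmf_finite finite_subset[OF subP finite_block_pairs])
  ultimately show ?thesis using E by (simp add: P_def)
qed

section \<open>Entropy and means under small total variation\<close>

lemma total_variation_finite:
  assumes "finite Z" "set_pmf P \<subseteq> Z" "set_pmf Q \<subseteq> Z"
  shows "total_variation P Q = (\<Sum>z\<in>Z. \<bar>pmf P z - pmf Q z\<bar>) / 2"
proof -
  have "(\<Sum>\<^sub>\<infinity>z. \<bar>pmf P z - pmf Q z\<bar>) = (\<Sum>\<^sub>\<infinity>z\<in>Z. \<bar>pmf P z - pmf Q z\<bar>)"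
  proof (rule infsum_cong_neutral)
    fix z assume "z \<in> UNIV - Z"
    then have "z \<notin> set_pmf P" "z \<notin> set_pmf Q" using assms by auto
    then show "\<bar>pmf P z - pmf Q z\<bar> = 0" by (simp add: set_pmf_iff)
  qed auto
  then show ?thesis using assms(1) by (simp add: total_variation_def)
qed

text \<open>
  If \<open>P\<close> is close to \<open>Q\<close>, then \<open>P \<le> 2 Q\<close> off an event of small \<open>P\<close>-probability, so on the typical set
  of \<open>Q\<close> also \<open>- log P \<ge> t - 1\<close>. This replaces the continuity of entropy. As \<open>log 2 0 = 0\<close>, points
  outside the support of \<open>Q\<close> may be counted as atypical, which costs nothing.
\<close>
lemma pmf_entropy_ge_typical:
  assumes Z: "finite Z" "set_pmf P \<subseteq> Z" "set_pmf Q \<subseteq> Z"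
  obtains a where "1 - measure_pmf.prob Q {z. - t < log 2 (pmf Q z)} - 6 * total_variation P Q \<le> a" "a \<le> 1"
    "a * (t - 1) \<le> pmf_entropy P"
proof
  define B where "B = {z. - t < log 2 (pmf Q z)}"
  define D where "D = {z. 2 * pmf Q z < pmf P z}"
  define G where "G = - (B \<union> D)"
  let ?T = "\<Sum>z\<in>Z. \<bar>pmf P z - pmf Q z\<bar>"
  have prob: "measure_pmf.prob R S = (\<Sum>z\<in>Z \<inter> S. pmf R z)" if "set_pmf R \<subseteq> Z" for R S
  proof -
    have "measure_pmf.prob R S = measure_pmf.prob R (Z \<inter> S)"
      using that by (intro measure_pmf.finite_measure_eq_AE) (auto simp: AE_measure_pmf_iff)
    then show ?thesis using Z(1) by (simp add: measure_measure_pmf_finite)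
  qed
  \<comment> \<open>On \<open>D\<close> the difference \<open>P - Q\<close> exceeds
    \<open>P / 2\<close>.\<close>
  have "measure_pmf.prob P D \<le> (\<Sum>z\<in>Z \<inter> D. 2 * \<bar>pmf P z - pmf Q z\<bar>)"
    unfolding prob[OF Z(2)]
  proof (rule sum_mono)
    fix z assume "z \<in> Z \<inter> D"
    then show "pmf P z \<le> 2 * \<bar>pmf P z - pmf Q z\<bar>"
      using abs_ge_self[of "pmf P z - pmf Q z"] by (simp add: D_def)
  qed
  also have "\<dots> \<le> (\<Sum>z\<in>Z. 2 * \<bar>pmf P z - pmf Q z\<bar>)"
    using Z(1) by (intro sum_mono2) auto
  finally have D: "measure_pmf.prob P D \<le> 2 * ?T" by (simp add: sum_distrib_left)
  have "measure_pmf.prob P B \<le> (\<Sum>z\<in>Z \<inter> B. pmf Q z + \<bar>pmf P z - pmf Q z\<bar>)"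
    unfolding prob[OF Z(2)] by (intro sum_mono) auto
  also have "\<dots> = measure_pmf.prob Q B + (\<Sum>z\<in>Z \<inter> B. \<bar>pmf P z - pmf Q z\<bar>)"
    by (simp add: sum.distrib prob[OF Z(3)])
  also have "(\<Sum>z\<in>Z \<inter> B. \<bar>pmf P z - pmf Q z\<bar>) \<le> ?T"
    using Z(1) by (intro sum_mono2) auto
  finally have B: "measure_pmf.prob P B \<le> measure_pmf.prob Q B + ?T" by simp
  have "1 - measure_pmf.prob P G = measure_pmf.prob P (B \<union> D)"
    using measure_pmf.prob_compl[of "B \<union> D" P] by (simp add: G_def Compl_eq_Diff_UNIV)
  also have "\<dots> \<le> measure_pmf.prob P B + measure_pmf.prob P D"
    by (rule measure_Un_le) auto
  \<comment> \<open>\<open>D\<close> costs \<open>2 * ?T\<close> and \<open>B\<close> costs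
    \<open>?T\<close>; total variation is \<open>?T / 2\<close>, whence the factor 6.\<close>
  finally show "1 - measure_pmf.prob Q {z. - t < log 2 (pmf Q z)} - 6 * total_variation P Q \<le> measure_pmf.prob P G"
    using B D by (simp add: total_variation_finite[OF Z] B_def)
  show "measure_pmf.prob P G \<le> 1" by (rule measure_pmf.prob_le_1)
  have fin: "finite (set_pmf P)" using finite_subset[OF Z(2,1)] .
  \<comment> \<open>The exact mass of \<open>G\<close> is kept as \<open>a\<close>: the sign of
    \<open>t - 1\<close> is unknown, so \<open>a\<close> cannot be replaced by its lower bound. Off
    \<open>G\<close> the entropy integrand is simply nonnegative.\<close>
  have "measure_pmf.prob P G * (t - 1) = measure_pmf.expectation P (\<lambda>z. indicat_real G z * (t - 1))"
    by simp
  also have "\<dots> \<le> pmf_entropy P"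
    unfolding pmf_entropy_def
  proof (rule expectation_mono_finite[OF fin])
    fix z assume z: "z \<in> set_pmf P"
    then have pos: "0 < pmf P z" by (rule pmf_positive)
    show "indicat_real G z * (t - 1) \<le> - log 2 (pmf P z)"
    proof (cases "z \<in> G")
      case True
      then have "pmf P z \<le> 2 * pmf Q z" "log 2 (pmf Q z) \<le> - t" by (auto simp: G_def B_def D_def)
      moreover from this have "log 2 (pmf P z) \<le> log 2 (2 * pmf Q z)" "0 < pmf Q z"
        using pos by (auto intro!: log_mono)
      ultimately show ?thesis using True by (simp add: log_mult)
    next
      case False
      have "log 2 (pmf P z) \<le> log 2 1" using pos by (intro log_mono) (auto simp: pmf_le_1)
      then show ?thesis using False by simp
    qed
  qed
  finally show "measure_pmf.prob P G * (t - 1) \<le> pmf_entropy P" .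
qed

text \<open>The relabelling inside \<open>memoryless_source\<close>, named so that its injectivity
  can carry masses and total variation over from lists of pairs.\<close>

definition unzip_list :: "('a \<times> 'b) list \<Rightarrow> 'a list \<times> 'b list" where
  "unzip_list zs = (map fst zs, map snd zs)"

lemma inj_unzip_list: "inj unzip_list"
  by (rule inj_on_inverseI[where g = "\<lambda>(xs, ys). zip xs ys"]) (simp add: unzip_list_def zip_map_fst_snd)

lemma memoryless_source_eq: "memoryless_source p n = map_pmf unzip_list (replicate_pmf n p)"
  by (simp add: memoryless_source_def unzip_list_def[abs_def])

lemma memoryless_source_subset: "set_pmf (memoryless_source p n) \<subseteq> block_pairs n"
  by (auto simp: memoryless_source_eq set_replicate_pmf unzip_list_def block_pairs_def)

lemma block_sum_unzip_list:
  "length zs = n \<Longrightarrow> block_sum g n (unzip_list zs) = sum_list (map g zs)"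
  by (auto simp: block_sum_def unzip_list_def sum_list_sum_nth atLeast0LessThan intro!: sum.cong)

lemma expectation_memoryless_block_sum:
  fixes p :: "('a::finite \<times> 'b::finite) pmf"
  shows "measure_pmf.expectation (memoryless_source p n) (block_sum g n) = real n * measure_pmf.expectation p g"
proof -
  have "measure_pmf.expectation (memoryless_source p n) (block_sum g n)
      = measure_pmf.expectation (replicate_pmf n p) (\<lambda>zs. sum_list (map g zs))"
    unfolding memoryless_source_eq integral_map_pmf
    by (rule expectation_cong_pmf) (simp add: set_replicate_pmf block_sum_unzip_list)
  then show ?thesis by (simp add: expectation_replicate_sum_list)
qed

lemma log2_pmf_replicate:
  assumes "zs \<in> set_pmf (replicate_pmf n p)"
  shows "log 2 (pmf (replicate_pmf n p) zs) = sum_list (map (\<lambda>z. log 2 (pmf p z)) zs)"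
proof -
  have "length zs = n" "set zs \<subseteq> set_pmf p"
    using assms by (auto simp: set_replicate_pmf)
  then show ?thesis
    unfolding replicate_pmf_eq_seq_pmf
    by (subst log2_pmf_seq_pmf) (auto simp: sum_list_sum_nth atLeast0LessThan)
qed

text \<open>The half of the asymptotic equipartition property that excludes too likely blocks: the
  weak law for \<open>log 2 (pmf p z)\<close>, in the form that
  \<open>pmf_entropy_ge_typical\<close> uses with
  \<open>t = n * (pmf_entropy p - \<delta>)\<close>.\<close>

lemma memoryless_source_typical:
  fixes p :: "('a::finite \<times> 'b::finite) pmf"
  assumes "0 < \<delta>"
  shows "(\<lambda>n. measure_pmf.prob (memoryless_source p n)
    {z. - (real n * (pmf_entropy p - \<delta>)) < log 2 (pmf (memoryless_source p n) z)}) \<longlonglongrightarrow> 0"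
proof (rule tendsto_sandwich[OF _ _ tendsto_const])
  let ?l = "\<lambda>z. log 2 (pmf p z)"
  have H: "measure_pmf.expectation p ?l = - pmf_entropy p"
    by (simp add: pmf_entropy_def)
  show "(\<lambda>n. measure_pmf.prob (replicate_pmf n p)
      {zs. real n * \<delta> \<le> \<bar>sum_list (map ?l zs) - real n * measure_pmf.expectation p ?l\<bar>}) \<longlonglongrightarrow> 0"
    by (rule replicate_pmf_weak_law) (use assms in auto)
  show "\<forall>\<^sub>F n in sequentially. measure_pmf.prob (memoryless_source p n)
      {z. - (real n * (pmf_entropy p - \<delta>)) < log 2 (pmf (memoryless_source p n) z)}
    \<le> measure_pmf.prob (replicate_pmf n p)
      {zs. real n * \<delta> \<le> \<bar>sum_list (map ?l zs) - real n * measure_pmf.expectation p ?l\<bar>}"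
  proof (intro always_eventually allI)
    fix n
    have "measure_pmf.prob (memoryless_source p n)
      {z. - (real n * (pmf_entropy p - \<delta>)) < log 2 (pmf (memoryless_source p n) z)}
      = measure_pmf.prob (replicate_pmf n p) {zs. - (real n * (pmf_entropy p - \<delta>)) < log 2 (pmf (replicate_pmf n p) zs)}"
      by (simp add: memoryless_source_eq vimage_def pmf_map_inj'[OF inj_unzip_list])
    also have "\<dots> \<le> measure_pmf.prob (replicate_pmf n p)
      {zs. real n * \<delta> \<le> \<bar>sum_list (map ?l zs) - real n * measure_pmf.expectation p ?l\<bar>}"
      by (intro measure_pmf.finite_measure_mono_AE)
        (auto simp: AE_measure_pmf_iff log2_pmf_replicate H algebra_simps)
    finally show "measure_pmf.prob (memoryless_source p n)
      {z. - (real n * (pmf_entropy p - \<delta>)) < log 2 (pmf (memoryless_source p n) z)}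
      \<le> measure_pmf.prob (replicate_pmf n p)
      {zs. real n * \<delta> \<le> \<bar>sum_list (map ?l zs) - real n * measure_pmf.expectation p ?l\<bar>}" .
  qed
qed simp

lemma expectation_diff_le_total_variation:
  fixes f :: "'c \<Rightarrow> real"
  assumes Z: "finite Z" "set_pmf P \<subseteq> Z" "set_pmf Q \<subseteq> Z" and f: "\<And>z. z \<in> Z \<Longrightarrow> \<bar>f z\<bar> \<le> C"
  shows "measure_pmf.expectation P f \<le> measure_pmf.expectation Q f + 2 * C * total_variation P Q"
proof -
  have E: "measure_pmf.expectation R f = (\<Sum>z\<in>Z. pmf R z * f z)" if "set_pmf R \<subseteq> Z" for R
    using that by (subst integral_measure_pmf[OF Z(1)]) auto
  have "measure_pmf.expectation P f - measure_pmf.expectation Q f = (\<Sum>z\<in>Z. (pmf P z - pmf Q z) * f z)"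
    by (simp add: E Z sum_subtractf left_diff_distrib)
  also have "\<dots> \<le> (\<Sum>z\<in>Z. \<bar>pmf P z - pmf Q z\<bar> * C)"
  proof (rule sum_mono)
    fix z assume "z \<in> Z"
    then have "\<bar>pmf P z - pmf Q z\<bar> * \<bar>f z\<bar> \<le> \<bar>pmf P z - pmf Q z\<bar> * C"
      by (intro mult_left_mono f) auto
    then show "(pmf P z - pmf Q z) * f z \<le> \<bar>pmf P z - pmf Q z\<bar> * C"
      by (simp flip: abs_mult)
  qed
  also have "\<dots> = 2 * C * total_variation P Q"
    by (simp add: total_variation_finite[OF Z] flip: sum_distrib_right)
  finally show ?thesis by simp
qed

text \<open>The block bound is divided by \<open>n\<close>: the 1 of the typicality estimate becomes
  \<open>1 / n\<close>, and the mean of \<open>block_sum\<close>, whose values are bounded by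
  \<open>n * C\<close>, shifts by at most \<open>2 * C * \<tau> n\<close> per symbol. In the limit
  \<open>h\<close> minus the \<open>p\<close>-mean of \<open>g\<close> is at most
  \<open>R\<close>.\<close>

lemma approximately_generable_imp_rate_ge:
  fixes p :: "('a::finite \<times> 'b::finite) pmf"
  assumes "approximately_generable p R"
  shows "wyner_common_information p \<le> R"
proof (rule field_le_epsilon)
  fix \<epsilon> :: real assume \<epsilon>: "0 < \<epsilon>"
  obtain W decX decY where code: "\<forall>\<^sub>F n in sequentially. simulation_code (W n) (decX n) (decY n) R n"
    and TV: "(\<lambda>n. total_variation (code_output (W n) (decX n) (decY n)) (memoryless_source p n)) \<longlonglongrightarrow> 0"
    using assms unfolding approximately_generable_def by blast
  \<comment> \<open>One half of \<open>\<epsilon>\<close> pays for the affine bound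
    \<open>g\<close>, the other for typicality.\<close>
  define \<delta> where "\<delta> = \<epsilon> / 2"
  have \<delta>: "0 < \<delta>" using \<epsilon> by (simp add: \<delta>_def)
  obtain g where g: "\<And>A B. pmf_entropy A + pmf_entropy B \<le> measure_pmf.expectation (pair_pmf A B) g"
    and pg: "measure_pmf.expectation p g \<le> pmf_entropy p - wyner_common_information p + \<delta>"
    using wyner_common_information_characterization[of p] \<delta> by metis
  define C where "C = (\<Sum>z\<in>UNIV. \<bar>g z\<bar>)"
  have C: "\<bar>g z\<bar> \<le> C" for z unfolding C_def by (rule member_le_sum) auto
  define P where "P n = code_output (W n) (decX n) (decY n)" for n
  define Q where "Q n = memoryless_source p n" for n
  define \<tau> where "\<tau> n = total_variation (P n) (Q n)" for n
  define h where "h = pmf_entropy p - \<delta>"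
  define \<eta> where "\<eta> n = measure_pmf.prob (Q n) {z. - (real n * h) < log 2 (pmf (Q n) z)}" for n
  have \<tau>: "\<tau> \<longlonglongrightarrow> 0" using TV by (simp add: \<tau>_def[abs_def] P_def Q_def)
  have \<eta>: "\<eta> \<longlonglongrightarrow> 0" using memoryless_source_typical[OF \<delta>, of p] by (simp add: \<eta>_def[abs_def] Q_def h_def)
  define bounds where "bounds n a \<longleftrightarrow> 1 - \<eta> n - 6 * \<tau> n \<le> a \<and> a \<le> 1 \<and>
      a * (h - 1 / real n) - measure_pmf.expectation p g - 2 * C * \<tau> n \<le> R" for n and a :: real
  have "\<forall>\<^sub>F n in sequentially. \<exists>a. bounds n a"
    using code
  proof eventually_elim
    case (elim n)
    have n: "0 < n" using elim by (simp add: simulation_code_def)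
    have Z: "set_pmf (P n) \<subseteq> block_pairs n" "set_pmf (Q n) \<subseteq> block_pairs n"
      using simulation_code_output_subset[OF elim] memoryless_source_subset by (auto simp: P_def Q_def)
    obtain a where a: "1 - \<eta> n - 6 * \<tau> n \<le> a" "a \<le> 1" "a * (real n * h - 1) \<le> pmf_entropy (P n)"
      using pmf_entropy_ge_typical[OF finite_block_pairs Z, of "real n * h"] unfolding \<eta>_def \<tau>_def by blast
    have "\<bar>block_sum g n z\<bar> \<le> real n * C" for z
      using sum_mono[of "{..<n}" "\<lambda>i. \<bar>g (fst z ! i, snd z ! i)\<bar>" "\<lambda>_. C"] C
      by (auto simp: block_sum_def intro: order.trans[OF sum_abs])
    then have "measure_pmf.expectation (P n) (block_sum g n) \<le> real n * measure_pmf.expectation p g + 2 * (real n * C) * \<tau> n"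
      using expectation_diff_le_total_variation[OF finite_block_pairs Z, of "block_sum g n" "real n * C"]
      by (simp add: Q_def expectation_memoryless_block_sum \<tau>_def)
    moreover have "pmf_entropy (P n) - measure_pmf.expectation (P n) (block_sum g n) \<le> real n * R"
      unfolding P_def by (rule simulation_code_rate_ge[OF elim g])
    ultimately have "a * (real n * h - 1) - real n * measure_pmf.expectation p g - 2 * (real n * C) * \<tau> n \<le> real n * R"
      using a(3) by simp
    also have "a * (real n * h - 1) - real n * measure_pmf.expectation p g - 2 * (real n * C) * \<tau> n
        = real n * (a * (h - 1 / real n) - measure_pmf.expectation p g - 2 * C * \<tau> n)"
      using n by (simp add: field_simps)
    finally show ?case using a n unfolding bounds_def by auto
  qed
  moreover define a where "a n = (SOME a. bounds n a)" for n
  ultimately have "\<forall>\<^sub>F n in sequentially. bounds n (a n)"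
    unfolding a_def by (elim eventually_mono) (rule someI_ex)
  then have a: "\<forall>\<^sub>F n in sequentially. 1 - \<eta> n - 6 * \<tau> n \<le> a n \<and> a n \<le> 1 \<and>
      a n * (h - 1 / real n) - measure_pmf.expectation p g - 2 * C * \<tau> n \<le> R"
    unfolding bounds_def .
  have "a \<longlonglongrightarrow> 1"
  proof (rule tendsto_sandwich)
    show "(\<lambda>n. 1 - \<eta> n - 6 * \<tau> n) \<longlonglongrightarrow> 1"
      using \<eta> \<tau> by (auto intro!: tendsto_eq_intros)
    show "\<forall>\<^sub>F n in sequentially. 1 - \<eta> n - 6 * \<tau> n \<le> a n" "\<forall>\<^sub>F n in sequentially. a n \<le> 1"
      using a by (auto elim: eventually_mono)
  qed simp
  then have "(\<lambda>n. a n * (h - 1 / real n) - measure_pmf.expectation p g - 2 * C * \<tau> n)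
      \<longlonglongrightarrow> 1 * (h - 0) - measure_pmf.expectation p g - 2 * C * 0"
    by (intro tendsto_intros \<tau> lim_const_over_n)
  then have "1 * (h - 0) - measure_pmf.expectation p g - 2 * C * 0 \<le> R"
    by (rule tendsto_upperbound) (use a in \<open>auto elim: eventually_mono\<close>)
  then show "wyner_common_information p \<le> R + \<epsilon>"
    using pg by (simp add: h_def \<delta>_def)
qed

section \<open>Soft covering\<close>

text \<open>The probabilistic method: some codebook is at least as good as the average one.\<close>

lemma exists_le_expectation:
  fixes f :: "'c \<Rightarrow> real"
  assumes fin: "finite (set_pmf P)"
  shows "\<exists>x\<in>set_pmf P. f x \<le> measure_pmf.expectation P f"
proof (rule ccontr)
  let ?m = "measure_pmf.expectation P f"
  assume "\<not> ?thesis"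
  then have "0 < (\<Sum>x\<in>set_pmf P. pmf P x * (f x - ?m))"
    using fin set_pmf_not_empty[of P] by (intro sum_pos) (auto simp: pmf_positive not_le)
  also have "\<dots> = measure_pmf.expectation P (\<lambda>x. f x - ?m)"
    by (simp add: integral_measure_pmf[OF fin])
  also have "\<dots> = 0" using fin by (simp add: integrable_measure_pmf_finite)
  finally show False by simp
qed

text \<open>Jensen's inequality, read off from the nonnegative variance of the absolute
  value.\<close>

lemma expectation_abs_le_sqrt:
  fixes f :: "'c \<Rightarrow> real"
  assumes fin: "finite (set_pmf P)"
  shows "measure_pmf.expectation P (\<lambda>x. \<bar>f x\<bar>) \<le> sqrt (measure_pmf.expectation P (\<lambda>x. (f x)\<^sup>2))"
proof (rule real_le_rsqrt)
  have int: "integrable (measure_pmf P) g" for g :: "_ \<Rightarrow> real"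
    using fin by (rule integrable_measure_pmf_finite)
  have "0 \<le> measure_pmf.variance P (\<lambda>x. \<bar>f x\<bar>)" by (rule measure_pmf.variance_positive)
  also have "\<dots> = measure_pmf.expectation P (\<lambda>x. (f x)\<^sup>2) - (measure_pmf.expectation P (\<lambda>x. \<bar>f x\<bar>))\<^sup>2"
    by (subst measure_pmf.variance_eq) (simp_all add: int)
  finally show "(measure_pmf.expectation P (\<lambda>x. \<bar>f x\<bar>))\<^sup>2 \<le> measure_pmf.expectation P (\<lambda>x. (f x)\<^sup>2)" by simp
qed

text \<open>The standard deviation of a mean of \<open>M\<close> independent draws, with the
  variance bounded by the second moment.\<close>

lemma expectation_sample_mean_deviation:
  fixes f :: "'c \<Rightarrow> real"
  assumes fin: "finite (set_pmf Q)" and M: "0 < M"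
  shows "measure_pmf.expectation (replicate_pmf M Q)
      (\<lambda>cs. \<bar>sum_list (map f cs) / real M - measure_pmf.expectation Q f\<bar>)
    \<le> sqrt (measure_pmf.expectation Q (\<lambda>c. (f c)\<^sup>2) / real M)"
proof -
  define \<mu> where "\<mu> = measure_pmf.expectation Q f"
  let ?R = "replicate_pmf M Q"
  have int: "integrable (measure_pmf Q) g" for g :: "_ \<Rightarrow> real"
    using fin by (rule integrable_measure_pmf_finite)
  have "measure_pmf.expectation ?R (\<lambda>cs. (sum_list (map f cs) / real M - \<mu>)\<^sup>2)
      = measure_pmf.expectation ?R (\<lambda>cs. (sum_list (map (\<lambda>c. f c - \<mu>) cs))\<^sup>2 / (real M)\<^sup>2)"
  proof (rule expectation_cong_pmf)
    fix cs assume "cs \<in> set_pmf ?R"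
    then have "sum_list (map (\<lambda>c. f c - \<mu>) cs) = sum_list (map f cs) - real M * \<mu>"
      by (simp add: sum_list_subtractf set_replicate_pmf sum_list_triv)
    then show "(sum_list (map f cs) / real M - \<mu>)\<^sup>2 = (sum_list (map (\<lambda>c. f c - \<mu>) cs))\<^sup>2 / (real M)\<^sup>2"
      using M by (simp add: diff_divide_distrib flip: power_divide)
  qed
  also have "\<dots> = real M * measure_pmf.expectation Q (\<lambda>c. (f c - \<mu>)\<^sup>2) / (real M)\<^sup>2"
    using fin by (simp add: expectation_replicate_sum_list_square int \<mu>_def)
  also have "measure_pmf.expectation Q (\<lambda>c. (f c - \<mu>)\<^sup>2) = measure_pmf.expectation Q (\<lambda>c. (f c)\<^sup>2) - \<mu>\<^sup>2"
    unfolding \<mu>_def by (rule measure_pmf.variance_eq) (rule int)+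
  also have "real M * (measure_pmf.expectation Q (\<lambda>c. (f c)\<^sup>2) - \<mu>\<^sup>2) / (real M)\<^sup>2
      \<le> measure_pmf.expectation Q (\<lambda>c. (f c)\<^sup>2) / real M"
    using M by (simp add: power2_eq_square divide_right_mono)
  finally have "sqrt (measure_pmf.expectation ?R (\<lambda>cs. (sum_list (map f cs) / real M - \<mu>)\<^sup>2))
      \<le> sqrt (measure_pmf.expectation Q (\<lambda>c. (f c)\<^sup>2) / real M)" by simp
  then show ?thesis
    using expectation_abs_le_sqrt[OF finite_set_replicate_pmf[OF fin, of M], of "\<lambda>cs. sum_list (map f cs) / real M - \<mu>"]
    unfolding \<mu>_def by linarith
qed

text \<open>
  The part of \<open>F u z\<close> above the threshold \<open>T P(z)\<close> is estimated by its mean; the part below has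
  second moment at most \<open>T P(z)\<^sup>2\<close>, so its sample mean deviates by \<open>P(z) sqrt (T / M)\<close> on average.
\<close>
lemma random_codebook:
  fixes Q :: "'u pmf" and F :: "'u \<Rightarrow> 'z pmf"
  assumes fin: "finite (set_pmf Q)" and Z: "finite Z" "\<And>u. u \<in> set_pmf Q \<Longrightarrow> set_pmf (F u) \<subseteq> Z"
    and M: "0 < M" and T: "0 \<le> T"
  defines "P \<equiv> bind_pmf Q F"
  shows "\<exists>cs. length cs = M \<and> set cs \<subseteq> set_pmf Q \<and>
    (\<Sum>z\<in>Z. \<bar>sum_list (map (\<lambda>u. pmf (F u) z) cs) / real M - pmf P z\<bar>)
      \<le> sqrt (T / real M) + 2 * measure_pmf.prob (channel_joint Q F) {(u, z). T * pmf P z < pmf (F u) z}"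
proof -
  define R where "R = replicate_pmf M Q"
  define f where "f z u = (if pmf (F u) z \<le> T * pmf P z then pmf (F u) z else 0)" for z u
  define h where "h z u = (if pmf (F u) z \<le> T * pmf P z then 0 else pmf (F u) z)" for z u
  define \<mu> where "\<mu> z = measure_pmf.expectation Q (f z)" for z
  define \<nu> where "\<nu> z = measure_pmf.expectation Q (h z)" for z
  have split: "pmf (F u) z = f z u + h z u" for u z by (simp add: f_def h_def)
  have finR: "finite (set_pmf R)" unfolding R_def by (rule finite_set_replicate_pmf[OF fin])
  have intQ: "integrable (measure_pmf Q) g" and intR: "integrable (measure_pmf R) g'"
    for g :: "_ \<Rightarrow> real" and g' :: "_ \<Rightarrow> real"
    using fin finR by (auto intro: integrable_measure_pmf_finite)
  have h_nonneg: "0 \<le> h z u" and f_nonneg: "0 \<le> f z u" for z u by (auto simp: h_def f_def)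
  have \<nu>_nonneg: "0 \<le> \<nu> z" for z unfolding \<nu>_def by (intro integral_nonneg_AE) (simp add: h_nonneg)
  have P: "pmf P z = \<mu> z + \<nu> z" for z
    by (simp add: P_def pmf_bind split \<mu>_def \<nu>_def intQ)
  let ?dev = "\<lambda>cs z. \<bar>sum_list (map (\<lambda>u. pmf (F u) z) cs) / real M - pmf P z\<bar>"
  have bound_z: "measure_pmf.expectation R (\<lambda>cs. ?dev cs z) \<le> pmf P z * sqrt (T / real M) + 2 * \<nu> z" for z
  proof -
    have "?dev cs z \<le> \<bar>sum_list (map (f z) cs) / real M - \<mu> z\<bar> + sum_list (map (h z) cs) / real M + \<nu> z" for cs
    proof -
      have "sum_list (map (\<lambda>u. pmf (F u) z) cs) = sum_list (map (f z) cs) + sum_list (map (h z) cs)"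
        by (simp add: split sum_list_addf)
      moreover have "0 \<le> sum_list (map (h z) cs) / real M"
        by (intro divide_nonneg_nonneg sum_list_nonneg) (auto simp: h_nonneg)
      ultimately show ?thesis using \<nu>_nonneg[of z] by (simp add: P add_divide_distrib)
    qed
    then have "measure_pmf.expectation R (\<lambda>cs. ?dev cs z)
        \<le> measure_pmf.expectation R (\<lambda>cs. \<bar>sum_list (map (f z) cs) / real M - \<mu> z\<bar> + sum_list (map (h z) cs) / real M + \<nu> z)"
      by (intro expectation_mono_finite[OF finR])
    also have "\<dots> = measure_pmf.expectation R (\<lambda>cs. \<bar>sum_list (map (f z) cs) / real M - \<mu> z\<bar>)
        + measure_pmf.expectation R (\<lambda>cs. sum_list (map (h z) cs)) / real M + \<nu> z"
      by (simp add: intR)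
    \<comment> \<open>The large part contributes \<open>\<nu> z\<close> twice, through its sample
      mean and through its share of \<open>pmf P z\<close>; hence the factor 2.\<close>
    also have "measure_pmf.expectation R (\<lambda>cs. sum_list (map (h z) cs)) / real M = \<nu> z"
      using M by (simp add: R_def expectation_replicate_sum_list[OF fin] \<nu>_def)
    also have "measure_pmf.expectation R (\<lambda>cs. \<bar>sum_list (map (f z) cs) / real M - \<mu> z\<bar>)
        \<le> sqrt (measure_pmf.expectation Q (\<lambda>u. (f z u)\<^sup>2) / real M)"
      unfolding R_def \<mu>_def by (rule expectation_sample_mean_deviation[OF fin M])
    also have "\<dots> \<le> sqrt ((pmf P z)\<^sup>2 * (T / real M))"
    proof -
      \<comment> \<open>\<open>f z u\<close> is at most \<open>T * pmf P z\<close>, so one factor of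
        the square is replaced by the threshold.\<close>
      have "measure_pmf.expectation Q (\<lambda>u. (f z u)\<^sup>2) \<le> measure_pmf.expectation Q (\<lambda>u. T * pmf P z * f z u)"
        by (rule expectation_mono_finite[OF fin])
          (auto simp: f_def power2_eq_square intro: mult_right_mono)
      also have "\<dots> = T * pmf P z * \<mu> z" by (simp add: \<mu>_def)
      also have "\<dots> \<le> T * pmf P z * pmf P z"
        by (intro mult_left_mono mult_nonneg_nonneg T pmf_nonneg) (use \<nu>_nonneg[of z] in \<open>simp add: P\<close>)
      finally show ?thesis by (simp add: power2_eq_square divide_right_mono mult.assoc mult.commute mult.left_commute)
    qed
    also have "\<dots> = pmf P z * sqrt (T / real M)" unfolding real_sqrt_mult by simp
    finally show ?thesis by simp
  qed
  have sumP: "(\<Sum>z\<in>Z. pmf P z) = 1"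
    using Z by (intro sum_pmf_eq_1) (auto simp: P_def)
  have sum\<nu>: "(\<Sum>z\<in>Z. \<nu> z) = measure_pmf.prob (channel_joint Q F) {(u, z). T * pmf P z < pmf (F u) z}" (is "_ = measure_pmf.prob _ ?S")
  proof -
    have "measure_pmf.prob (channel_joint Q F) ?S = measure_pmf.expectation (channel_joint Q F) (indicat_real ?S)" by simp
    also have "\<dots> = measure_pmf.expectation Q (\<lambda>u. measure_pmf.expectation (map_pmf (Pair u) (F u)) (indicat_real ?S))"
      unfolding channel_joint_def
      by (rule expectation_bind_finite[of "set_pmf Q \<times> Z"]) (use fin Z in auto)
    also have "\<dots> = measure_pmf.expectation Q (\<lambda>u. \<Sum>z\<in>Z. h z u)"
    proof (rule expectation_cong_pmf)
      fix u assume "u \<in> set_pmf Q"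
      then have "measure_pmf.expectation (F u) (\<lambda>z. indicat_real ?S (u, z)) = (\<Sum>z\<in>Z. pmf (F u) z * indicat_real ?S (u, z))"
        using Z by (subst integral_measure_pmf[OF Z(1)]) auto
      also have "\<dots> = (\<Sum>z\<in>Z. h z u)"
        by (intro sum.cong) (auto simp: h_def indicator_def)
      finally show "measure_pmf.expectation (map_pmf (Pair u) (F u)) (indicat_real ?S) = (\<Sum>z\<in>Z. h z u)"
        by (simp only: integral_map_pmf)
    qed
    also have "\<dots> = (\<Sum>z\<in>Z. \<nu> z)"
      unfolding \<nu>_def by (rule Bochner_Integration.integral_sum) (rule intQ)
    finally show ?thesis ..
  qed
  have "measure_pmf.expectation R (\<lambda>cs. \<Sum>z\<in>Z. ?dev cs z) = (\<Sum>z\<in>Z. measure_pmf.expectation R (\<lambda>cs. ?dev cs z))"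
    by (rule Bochner_Integration.integral_sum) (rule intR)
  also have "\<dots> \<le> (\<Sum>z\<in>Z. pmf P z * sqrt (T / real M) + 2 * \<nu> z)"
    by (intro sum_mono bound_z)
  also have "\<dots> = sqrt (T / real M) + 2 * measure_pmf.prob (channel_joint Q F) ?S"
    by (simp add: sum.distrib sumP sum\<nu> flip: sum_distrib_right sum_distrib_left)
  finally have E: "measure_pmf.expectation R (\<lambda>cs. \<Sum>z\<in>Z. ?dev cs z)
      \<le> sqrt (T / real M) + 2 * measure_pmf.prob (channel_joint Q F) ?S" .
  obtain cs where cs: "cs \<in> set_pmf R" "(\<Sum>z\<in>Z. ?dev cs z) \<le> measure_pmf.expectation R (\<lambda>cs. \<Sum>z\<in>Z. ?dev cs z)"
    using exists_le_expectation[OF finR, of "\<lambda>cs. \<Sum>z\<in>Z. ?dev cs z"] by blast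
  have "length cs = M" "set cs \<subseteq> set_pmf Q"
    using cs(1) by (auto simp: R_def set_replicate_pmf)
  then show ?thesis using order.trans[OF cs(2) E] by blast
qed

text \<open>Coordinatewise use of the channel on independent inputs amounts to independent
  input-output pairs, after exchanging the order of draws. This lets the weak law act on the
  information density.\<close>

lemma channel_joint_replicate:
  "channel_joint (replicate_pmf n W) (\<lambda>ws. seq_pmf (map V ws))
    = map_pmf unzip_list (replicate_pmf n (channel_joint W V))"
proof (induction n)
  case 0
  show ?case by (simp add: channel_joint_def unzip_list_def bind_return_pmf)
next
  case (Suc n)
  let ?Q = "replicate_pmf n W" and ?F = "\<lambda>ws. seq_pmf (map V ws)"
  have "map_pmf unzip_list (replicate_pmf (Suc n) (channel_joint W V))
      = bind_pmf (channel_joint W V) (\<lambda>s. map_pmf (\<lambda>t. (fst s # fst t, snd s # snd t))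
          (map_pmf unzip_list (replicate_pmf n (channel_joint W V))))"
    by (simp add: map_bind_pmf map_pmf_def bind_assoc_pmf bind_return_pmf unzip_list_def)
  also have "\<dots> = bind_pmf W (\<lambda>w. bind_pmf (V w) (\<lambda>z. bind_pmf ?Q (\<lambda>ws. bind_pmf (?F ws) (\<lambda>zs.
      return_pmf (w # ws, z # zs)))))"
    unfolding Suc.IH[symmetric]
    by (simp add: channel_joint_def map_pmf_def bind_assoc_pmf bind_return_pmf)
  also have "\<dots> = bind_pmf W (\<lambda>w. bind_pmf ?Q (\<lambda>ws. bind_pmf (V w) (\<lambda>z. bind_pmf (?F ws) (\<lambda>zs.
      return_pmf (w # ws, z # zs)))))"
    by (subst bind_commute_pmf) (rule refl)
  also have "\<dots> = channel_joint (replicate_pmf (Suc n) W) ?F"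
    by (simp add: channel_joint_def map_pmf_def bind_assoc_pmf bind_return_pmf pair_pmf_def)
  finally show ?case ..
qed

lemma bind_replicate_seq_pmf:
  "bind_pmf (replicate_pmf n W) (\<lambda>ws. seq_pmf (map V ws)) = replicate_pmf n (bind_pmf W V)"
proof (induction n)
  case (Suc n)
  have "bind_pmf (replicate_pmf (Suc n) W) (\<lambda>ws. seq_pmf (map V ws))
      = bind_pmf W (\<lambda>w. bind_pmf (replicate_pmf n W) (\<lambda>ws. bind_pmf (V w) (\<lambda>z.
          bind_pmf (seq_pmf (map V ws)) (\<lambda>zs. return_pmf (z # zs)))))"
    by (simp add: bind_assoc_pmf bind_return_pmf map_pmf_def pair_pmf_def)
  also have "\<dots> = bind_pmf W (\<lambda>w. bind_pmf (V w) (\<lambda>z. bind_pmf (replicate_pmf n W) (\<lambda>ws.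
          bind_pmf (seq_pmf (map V ws)) (\<lambda>zs. return_pmf (z # zs)))))"
    by (subst bind_commute_pmf) (rule refl)
  also have "\<dots> = replicate_pmf (Suc n) (bind_pmf W V)"
    by (simp add: bind_assoc_pmf flip: Suc.IH)
  finally show ?case .
qed (simp add: bind_return_pmf)

text \<open>On the support, the log-ratio of the block laws is a sum of independent copies of the
  information density, whose mean is below \<open>r\<close>. The event forces the sum to at least
  \<open>n * r\<close>, a deviation of at least \<open>n * \<delta>\<close>.\<close>

lemma information_density_tail:
  fixes W :: "'w pmf" and V :: "'w \<Rightarrow> 'c::finite pmf"
  assumes fin: "finite (set_pmf W)" and r: "measure_pmf.expectation (channel_joint W V)
    (\<lambda>(w, z). log 2 (pmf (V w) z) - log 2 (pmf (bind_pmf W V) z)) < r"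
  defines "p \<equiv> bind_pmf W V"
  shows "(\<lambda>n. measure_pmf.prob (channel_joint (replicate_pmf n W) (\<lambda>ws. seq_pmf (map V ws)))
    {(ws, zs). 2 powr (real n * r) * pmf (replicate_pmf n p) zs < pmf (seq_pmf (map V ws)) zs}) \<longlonglongrightarrow> 0"
proof (rule tendsto_sandwich[OF _ _ tendsto_const])
  define q where "q = channel_joint W V"
  define i where "i = (\<lambda>(w, z). log 2 (pmf (V w) z) - log 2 (pmf p z))"
  define \<delta> where "\<delta> = r - measure_pmf.expectation q i"
  have \<delta>: "0 < \<delta>" using r by (simp add: \<delta>_def q_def i_def p_def)
  have finq: "finite (set_pmf q)" using fin by (simp add: q_def channel_joint_def)
  show "(\<lambda>n. measure_pmf.prob (replicate_pmf n q)
      {ss. real n * \<delta> \<le> \<bar>sum_list (map i ss) - real n * measure_pmf.expectation q i\<bar>}) \<longlonglongrightarrow> 0"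
    by (rule replicate_pmf_weak_law[OF finq \<delta>])
  show "\<forall>\<^sub>F n in sequentially. measure_pmf.prob (channel_joint (replicate_pmf n W) (\<lambda>ws. seq_pmf (map V ws)))
      {(ws, zs). 2 powr (real n * r) * pmf (replicate_pmf n p) zs < pmf (seq_pmf (map V ws)) zs}
    \<le> measure_pmf.prob (replicate_pmf n q)
      {ss. real n * \<delta> \<le> \<bar>sum_list (map i ss) - real n * measure_pmf.expectation q i\<bar>}"
  proof (intro always_eventually allI)
    fix n
    have dens: "real n * \<delta> \<le> \<bar>sum_list (map i ss) - real n * measure_pmf.expectation q i\<bar>"
      if ss: "ss \<in> set_pmf (replicate_pmf n q)"
        and gt: "2 powr (real n * r) * pmf (replicate_pmf n p) (map snd ss) < pmf (seq_pmf (map V (map fst ss))) (map snd ss)" for ss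
    proof -
      have len: "length ss = n" and mem: "\<And>s. s \<in> set ss \<Longrightarrow> s \<in> set_pmf q"
        using ss by (auto simp: set_replicate_pmf)
      have V: "snd s \<in> set_pmf (V (fst s))" and W: "fst s \<in> set_pmf W" if "s \<in> set ss" for s
        using mem[OF that] by (auto simp: q_def channel_joint_def)
      have "map snd ss \<in> set_pmf (replicate_pmf n p)"
        using V W len by (force simp: set_replicate_pmf p_def)
      note pos = pmf_positive[OF this] and log_p = log2_pmf_replicate[OF this]
      have log_V: "log 2 (pmf (seq_pmf (map V (map fst ss))) (map snd ss)) = (\<Sum>s\<leftarrow>ss. log 2 (pmf (V (fst s)) (snd s)))"
        using V by (subst log2_pmf_seq_pmf) (auto simp: sum_list_sum_nth atLeast0LessThan)
      have "log 2 (2 powr (real n * r) * pmf (replicate_pmf n p) (map snd ss))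
          \<le> log 2 (pmf (seq_pmf (map V (map fst ss))) (map snd ss))"
        using gt pos by (intro log_mono) auto
      then have "real n * r \<le> sum_list (map i ss)"
        using pos by (simp add: log_mult log_p log_V[unfolded map_map o_def] i_def case_prod_beta' sum_list_subtractf o_def)
      then show ?thesis by (simp add: \<delta>_def right_diff_distrib)
    qed
    show "measure_pmf.prob (channel_joint (replicate_pmf n W) (\<lambda>ws. seq_pmf (map V ws)))
        {(ws, zs). 2 powr (real n * r) * pmf (replicate_pmf n p) zs < pmf (seq_pmf (map V ws)) zs}
      \<le> measure_pmf.prob (replicate_pmf n q)
        {ss. real n * \<delta> \<le> \<bar>sum_list (map i ss) - real n * measure_pmf.expectation q i\<bar>}"
      unfolding channel_joint_replicate measure_map_pmf q_def[symmetric]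
      using dens by (intro measure_pmf.finite_measure_mono_AE) (auto simp: AE_measure_pmf_iff unzip_list_def)
  qed
qed simp

text \<open>The threshold exponent \<open>r\<close> lies strictly between \<open>I\<close> and
  \<open>R\<close>: above \<open>I\<close> the tail vanishes, and below \<open>R\<close> the ratio
  of the threshold \<open>2 powr (n * r)\<close> to the codebook size \<open>2 ^ k n\<close> decays
  geometrically.\<close>

lemma soft_covering:
  fixes W :: "'w pmf" and V :: "'w \<Rightarrow> 'c::finite pmf"
  assumes fin: "finite (set_pmf W)" and R: "measure_pmf.expectation (channel_joint W V)
    (\<lambda>(w, z). log 2 (pmf (V w) z) - log 2 (pmf (bind_pmf W V) z)) < R"
    and k: "\<And>n. real n * R - 1 \<le> real (k n)"
  obtains cs :: "nat \<Rightarrow> 'w list list" and b :: "nat \<Rightarrow> real" where "b \<longlonglongrightarrow> 0" "\<And>n. length (cs n) = 2 ^ k n"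
    "\<And>n ws. ws \<in> set (cs n) \<Longrightarrow> length ws = n"
    "\<And>n. (\<Sum>zs | length zs = n. \<bar>sum_list (map (\<lambda>ws. pmf (seq_pmf (map V ws)) zs) (cs n)) / 2 ^ k n
      - pmf (replicate_pmf n (bind_pmf W V)) zs\<bar>) \<le> b n"
proof -
  define p where "p = bind_pmf W V"
  define I where "I = measure_pmf.expectation (channel_joint W V)
    (\<lambda>(w, z). log 2 (pmf (V w) z) - log 2 (pmf (bind_pmf W V) z))"
  define r where "r = (I + R) / 2"
  have r: "I < r" "r < R" using R by (auto simp: r_def I_def)
  define F where "F ws = seq_pmf (map V ws)" for ws
  define S where "S n = {(ws, zs). 2 powr (real n * r) * pmf (replicate_pmf n p) zs < pmf (F ws) zs}" for n
  \<comment> \<open>The factor 2 under the root absorbs the rounding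
    \<open>k n \<ge> n * R - 1\<close>.\<close>
  define b where "b n = sqrt (2 * (2 powr (r - R)) ^ n) + 2 * measure_pmf.prob (channel_joint (replicate_pmf n W) F) (S n)" for n
  have b: "b \<longlonglongrightarrow> 0"
  proof -
    have tail: "(\<lambda>n. measure_pmf.prob (channel_joint (replicate_pmf n W) F) (S n)) \<longlonglongrightarrow> 0"
      using information_density_tail[OF fin r(1)[unfolded I_def]] by (simp add: F_def[abs_def] S_def p_def)
    have geom: "(\<lambda>n. (2 powr (r - R)) ^ n) \<longlonglongrightarrow> 0"
      using r(2) powr_less_mono[of "r - R" 0 2] by (intro LIMSEQ_realpow_zero) auto
    have "b \<longlonglongrightarrow> sqrt (2 * 0) + 2 * 0"
      unfolding b_def by (intro tendsto_add tendsto_mult tendsto_const tendsto_real_sqrt tail geom)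
    then show ?thesis by simp
  qed
  have "\<exists>cs. length cs = 2 ^ k n \<and> set cs \<subseteq> set_pmf (replicate_pmf n W) \<and>
    (\<Sum>zs | length zs = n. \<bar>sum_list (map (\<lambda>ws. pmf (F ws) zs) cs) / 2 ^ k n - pmf (replicate_pmf n p) zs\<bar>) \<le> b n" for n
  proof -
    have "set_pmf (F ws) \<subseteq> {zs. length zs = n}" if "ws \<in> set_pmf (replicate_pmf n W)" for ws
      using that by (auto simp: F_def set_replicate_pmf dest: length_seq_pmf)
    then have "\<exists>cs. length cs = 2 ^ k n \<and> set cs \<subseteq> set_pmf (replicate_pmf n W) \<and>
      (\<Sum>zs | length zs = n. \<bar>sum_list (map (\<lambda>ws. pmf (F ws) zs) cs) / real (2 ^ k n) - pmf (bind_pmf (replicate_pmf n W) F) zs\<bar>)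
        \<le> sqrt (2 powr (real n * r) / real (2 ^ k n)) + 2 * measure_pmf.prob (channel_joint (replicate_pmf n W) F)
          {(ws, zs). 2 powr (real n * r) * pmf (bind_pmf (replicate_pmf n W) F) zs < pmf (F ws) zs}"
      by (intro random_codebook finite_set_replicate_pmf fin finite_lists_length) auto
    moreover have "bind_pmf (replicate_pmf n W) F = replicate_pmf n p"
      unfolding F_def[abs_def] p_def by (rule bind_replicate_seq_pmf)
    ultimately obtain cs where cs: "length cs = 2 ^ k n" "set cs \<subseteq> set_pmf (replicate_pmf n W)"
      "(\<Sum>zs | length zs = n. \<bar>sum_list (map (\<lambda>ws. pmf (F ws) zs) cs) / 2 ^ k n - pmf (replicate_pmf n p) zs\<bar>)
        \<le> sqrt (2 powr (real n * r) / real (2 ^ k n)) + 2 * measure_pmf.prob (channel_joint (replicate_pmf n W) F) (S n)"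
      unfolding S_def by auto
    have "sqrt (2 powr (real n * r) / real (2 ^ k n)) \<le> sqrt (2 * (2 powr (r - R)) ^ n)"
    proof -
      have "2 powr (real n * r) / real (2 ^ k n) = 2 powr (real n * r - real (k n))"
        by (simp add: powr_diff powr_realpow)
      also have "\<dots> \<le> 2 powr (1 + real n * (r - R))"
        using k[of n] by (intro powr_mono) (auto simp: right_diff_distrib)
      also have "\<dots> = 2 * (2 powr (r - R)) ^ n"
        by (simp add: powr_add powr_realpow[symmetric, of "2 powr (r - R)"] powr_powr mult.commute)
      finally show ?thesis by simp
    qed
    with cs(3) have "(\<Sum>zs | length zs = n. \<bar>sum_list (map (\<lambda>ws. pmf (F ws) zs) cs) / 2 ^ k n - pmf (replicate_pmf n p) zs\<bar>) \<le> b n"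
      unfolding b_def by linarith
    then show ?thesis using cs(1,2) by blast
  qed
  then have "\<forall>n. \<exists>cs. length cs = 2 ^ k n \<and> set cs \<subseteq> set_pmf (replicate_pmf n W) \<and>
    (\<Sum>zs | length zs = n. \<bar>sum_list (map (\<lambda>ws. pmf (F ws) zs) cs) / 2 ^ k n - pmf (replicate_pmf n p) zs\<bar>) \<le> b n"
    by (rule allI)
  from choice[OF this] obtain cs where cs: "\<forall>n. length (cs n) = 2 ^ k n \<and> set (cs n) \<subseteq> set_pmf (replicate_pmf n W) \<and>
    (\<Sum>zs | length zs = n. \<bar>sum_list (map (\<lambda>ws. pmf (F ws) zs) (cs n)) / 2 ^ k n - pmf (replicate_pmf n p) zs\<bar>) \<le> b n"
    by (rule exE)
  show thesis
  proof (rule that[of b cs])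
    show "length ws = n" if "ws \<in> set (cs n)" for n ws
      using cs that by (auto simp: set_replicate_pmf)
  qed (use b cs in \<open>auto simp: F_def p_def\<close>)
qed

section \<open>Achievability\<close>

lemma bool_lists_length_nonempty: "{u :: bool list. length u = j} \<noteq> {}"
  using Ex_list_of_length[of j] by blast

lemma set_pmf_uniform_bool_lists: "set_pmf (pmf_of_set {u :: bool list. length u = j}) = {u. length u = j}"
  by (rule set_pmf_of_set[OF bool_lists_length_nonempty finite_lists_length])

text \<open>
  The leaves of a complete binary tree of depth \<open>j\<close>, where the leaves in \<open>T\<close> are split once more,
  under the dyadic distribution. The optimal expected length is exactly \<open>j + card T / 2 ^ j\<close>, which
  realises any dyadic \<open>n R\<close>, and the first \<open>j\<close> bits are a uniform codeword index.
\<close>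
definition split_leaf :: "bool list set \<Rightarrow> bool list \<Rightarrow> bool list pmf" where
  "split_leaf T u = (if u \<in> T then map_pmf (\<lambda>b. u @ [b]) (pmf_of_set UNIV) else return_pmf u)"

definition split_tree :: "nat \<Rightarrow> bool list set \<Rightarrow> bool list pmf" where
  "split_tree j T = bind_pmf (pmf_of_set {u. length u = j}) (split_leaf T)"

lemma length_split_tree:
  assumes "v \<in> set_pmf (split_tree j T)"
  shows "length v = (if take j v \<in> T then Suc j else j)"
proof -
  obtain u where u: "length u = j" "v \<in> set_pmf (split_leaf T u)"
    using assms by (auto simp: split_tree_def set_pmf_uniform_bool_lists)
  show ?thesis
  proof (cases "u \<in> T")
    case True
    then obtain b where "v = u @ [b]" using u(2) by (auto simp: split_leaf_def)
    then show ?thesis using u(1) True by simp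
  next
    case False
    then have "v = u" using u(2) by (simp add: split_leaf_def)
    then show ?thesis using u(1) False by simp
  qed
qed

lemma length_split_tree_ge:
  "v \<in> set_pmf (split_tree j T) \<Longrightarrow> j \<le> length v"
  by (subst length_split_tree) auto

text \<open>The first \<open>j\<close> bits determine the length of a leaf, and a leaf shares them
  with each of its prefixes that is a leaf; equal lengths force equality.\<close>

lemma split_tree_prefix_free:
  assumes u: "u \<in> set_pmf (split_tree j T)" and v: "v \<in> set_pmf (split_tree j T)" and "prefix u v"
  shows "u = v"
proof -
  obtain w where w: "v = u @ w" using assms(3) by (auto simp: prefix_def)
  then have "take j u = take j v" using length_split_tree_ge[OF u] by simp
  then have "length u = length v"
    by (simp only: length_split_tree[OF u] length_split_tree[OF v])
  then show ?thesis using w by simp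
qed

text \<open>The source of optimality: the length of a leaf is at most its self-information, as
  \<open>prefix_code_expectation_le\<close> requires of \<open>d\<close>.\<close>

lemma pmf_split_tree_le:
  assumes v: "v \<in> set_pmf (split_tree j T)"
  shows "pmf (split_tree j T) v \<le> (1 / 2) ^ length v"
proof -
  have leaf: "pmf (split_leaf T u) v = 0" if "length u = j" "u \<noteq> take j v" for u
    using that by (auto simp: pmf_eq_0_set_pmf split_leaf_def)
  \<comment> \<open>Only the parent \<open>take j v\<close> can produce \<open>v\<close>.\<close>
  have "(\<Sum>u | length u = j. pmf (split_leaf T u) v) = (\<Sum>u\<in>{take j v}. pmf (split_leaf T u) v)"
    using leaf length_split_tree_ge[OF v] by (intro sum.mono_neutral_right finite_lists_length) auto
  then have pmf_v: "pmf (split_tree j T) v = pmf (split_leaf T (take j v)) v / 2 ^ j"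
    unfolding split_tree_def
    by (subst pmf_bind_pmf_of_set[OF bool_lists_length_nonempty finite_lists_length])
      (simp add: card_bool_lists_length)
  show ?thesis
  proof (cases "take j v \<in> T")
    case True
    then have len: "length v = Suc j" by (subst length_split_tree[OF v]) (rule if_P)
    then have v_eq: "take j v @ [v ! j] = v" using take_Suc_conv_app_nth[of j v] by simp
    have "inj (\<lambda>b. take j v @ [b])" by (auto simp: inj_def)
    from pmf_map_inj'[OF this, of "pmf_of_set UNIV" "v ! j"]
    have half: "pmf (split_leaf T (take j v)) v = 1 / 2"
      by (simp add: v_eq split_leaf_def True)
    show ?thesis unfolding pmf_v half len by (simp add: power_one_over)
  next
    case False
    then have "length v = j" by (subst length_split_tree[OF v]) (rule if_not_P)
    then show ?thesis by (simp add: pmf_v pmf_le_1 power_one_over divide_right_mono)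
  qed
qed

text \<open>Splitting is invisible to the first \<open>j\<close> bits, so the decoders see a uniform
  codeword index for every \<open>T\<close>.\<close>

lemma map_take_split_tree: "map_pmf (take j) (split_tree j T) = pmf_of_set {u. length u = j}"
proof -
  have "map_pmf (take j) (split_tree j T) = bind_pmf (pmf_of_set {u. length u = j}) (\<lambda>u. map_pmf (take j) (split_leaf T u))"
    by (simp add: split_tree_def map_bind_pmf)
  also have "\<dots> = bind_pmf (pmf_of_set {u. length u = j}) return_pmf"
  proof (rule bind_pmf_cong[OF refl])
    fix u :: "bool list" assume "u \<in> set_pmf (pmf_of_set {u. length u = j})"
    then have "length u = j" by (simp add: set_pmf_uniform_bool_lists)
    then show "map_pmf (take j) (split_leaf T u) = return_pmf u"
      by (simp add: split_leaf_def map_pmf_comp map_pmf_const)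
  qed
  finally show ?thesis by (simp add: bind_return_pmf')
qed

lemma finite_set_split_tree: "finite (set_pmf (split_tree j T))"
proof (rule finite_subset)
  show "set_pmf (split_tree j T) \<subseteq> {v. length v = j} \<union> {v. length v = Suc j}"
  proof
    fix v assume v: "v \<in> set_pmf (split_tree j T)"
    have "length v = j \<or> length v = Suc j" unfolding length_split_tree[OF v] by simp
    then show "v \<in> {v. length v = j} \<union> {v. length v = Suc j}" by simp
  qed
qed (simp add: finite_lists_length)

lemma expectation_length_split_tree:
  assumes T: "T \<subseteq> {u. length u = j}"
  shows "measure_pmf.expectation (split_tree j T) (\<lambda>v. real (length v)) = real j + real (card T) / 2 ^ j"
proof -
  let ?L = "{u :: bool list. length u = j}"
  have "measure_pmf.expectation (split_tree j T) (\<lambda>v. real (length v))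
      = (\<Sum>u\<in>?L. measure_pmf.expectation (split_leaf T u) (\<lambda>v. real (length v)) /\<^sub>R real (card ?L))"
    unfolding split_tree_def
    by (rule pmf_expectation_bind_pmf_of_set[OF bool_lists_length_nonempty finite_lists_length])
      (simp add: split_leaf_def)
  also have "\<dots> = (\<Sum>u\<in>?L. (real j + indicat_real T u) / 2 ^ j)"
  proof (rule sum.cong[OF refl])
    fix u assume "u \<in> ?L"
    then have "measure_pmf.expectation (split_leaf T u) (\<lambda>v. real (length v)) = real j + indicat_real T u"
      by (simp add: split_leaf_def)
    then show "measure_pmf.expectation (split_leaf T u) (\<lambda>v. real (length v)) /\<^sub>R real (card ?L)
        = (real j + indicat_real T u) / 2 ^ j"
      by (simp add: card_bool_lists_length divide_inverse)
  qed
  also have "\<dots> = (\<Sum>u\<in>?L. real j + indicat_real T u) / 2 ^ j"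
    by (rule sum_divide_distrib[symmetric])
  also have "(\<Sum>u\<in>?L. real j + indicat_real T u) = real j * 2 ^ j + real (card T)"
  proof -
    have "(\<Sum>u\<in>?L. indicat_real T u) = (\<Sum>u\<in>T. 1)"
      by (rule sum.mono_neutral_cong_right[OF finite_lists_length T]) auto
    then show ?thesis by (simp add: sum.distrib card_bool_lists_length)
  qed
  finally show ?thesis by (simp add: add_divide_distrib)
qed

definition split_index :: "nat \<Rightarrow> bool list set \<Rightarrow> nat pmf" where
  "split_index j T = map_pmf to_nat (split_tree j T)"

text \<open>The leaves themselves, read back by \<open>from_nat\<close>, form a code of this length.
  A competitor of finite expected length is compared through
  \<open>prefix_code_expectation_le\<close> with \<open>d\<close> the leaf length.\<close>

lemma is_min_expected_length_split_index:
  assumes T: "T \<subseteq> {u. length u = j}"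
  shows "is_min_expected_length (split_index j T) (ennreal (real j + real (card T) / 2 ^ j))"
proof -
  define l where "l = real j + real (card T) / 2 ^ j"
  have fin: "finite (set_pmf (split_index j T))"
    by (simp add: split_index_def finite_set_split_tree)
  have E: "measure_pmf.expectation (split_index j T) (\<lambda>w. real (length (from_nat w :: bool list))) = l"
    by (simp add: split_index_def expectation_length_split_tree[OF T] l_def)
  have l: "0 \<le> l" by (simp add: l_def)
  have "prefix_free_code (split_index j T) (from_nat :: nat \<Rightarrow> bool list)"
    unfolding prefix_free_code_def split_index_def
    using split_tree_prefix_free by (auto simp: inj_on_def)
  moreover have "expected_length (split_index j T) (from_nat :: nat \<Rightarrow> bool list) = ennreal l"
    unfolding expected_length_def E[symmetric]
    by (intro nn_integral_eq_integral integrable_measure_pmf_finite fin) simp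
  moreover have "ennreal l \<le> expected_length (split_index j T) c"
    if c: "prefix_free_code (split_index j T) c" for c
  proof (cases "expected_length (split_index j T) c")
    case (real t)
    have "l \<le> t"
      unfolding E[symmetric]
    proof (rule prefix_code_expectation_le[OF c])
      show "expected_length (split_index j T) c = ennreal t" "0 \<le> t" using real by auto
    next
      fix w assume "w \<in> set_pmf (split_index j T)"
      then obtain v where v: "v \<in> set_pmf (split_tree j T)" "w = to_nat v"
        by (auto simp: split_index_def)
      have "pmf (split_index j T) w = pmf (split_tree j T) v"
        unfolding split_index_def v(2) by (rule pmf_map_inj') simp
      then have "pmf (split_index j T) w \<le> (1 / 2) ^ length v"
        using pmf_split_tree_le[OF v(1)] by simp
      then have "log 2 (pmf (split_index j T) w) \<le> log 2 ((1 / 2) ^ length v)"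
        using pmf_positive[OF \<open>w \<in> set_pmf (split_index j T)\<close>] by (intro log_mono) auto
      then show "real (length (from_nat w :: bool list)) \<le> - log 2 (pmf (split_index j T) w)"
        by (simp add: v(2) log_nat_power log_divide)
    qed (rule integrable_measure_pmf_finite[OF fin])
    then show ?thesis using real by (simp add: ennreal_leI)
  qed simp
  ultimately show ?thesis unfolding is_min_expected_length_def l_def by blast
qed

text \<open>Given the codeword the two blocks are independent, so separate decoders can produce
  them.\<close>

lemma unzip_seq_pmf_pair:
  "map_pmf unzip_list (seq_pmf (map (\<lambda>w. pair_pmf (A w) (B w)) ws))
    = pair_pmf (seq_pmf (map A ws)) (seq_pmf (map B ws))"
proof (induction ws)
  case Nil
  show ?case by (simp add: unzip_list_def)
next
  case (Cons w ws)
  have "map_pmf unzip_list (seq_pmf (map (\<lambda>w. pair_pmf (A w) (B w)) (w # ws)))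
      = map_pmf (\<lambda>(s, t). (fst s # fst t, snd s # snd t)) (pair_pmf (pair_pmf (A w) (B w))
          (map_pmf unzip_list (seq_pmf (map (\<lambda>w. pair_pmf (A w) (B w)) ws))))"
    by (simp add: map_pmf_comp unzip_list_def case_prod_beta' pair_map_pmf2)
  also have "\<dots> = bind_pmf (A w) (\<lambda>x. bind_pmf (B w) (\<lambda>y. bind_pmf (seq_pmf (map A ws)) (\<lambda>xs.
      bind_pmf (seq_pmf (map B ws)) (\<lambda>ys. return_pmf (x # xs, y # ys)))))"
    unfolding Cons.IH by (simp add: pair_pmf_def map_pmf_def bind_assoc_pmf bind_return_pmf)
  also have "\<dots> = bind_pmf (A w) (\<lambda>x. bind_pmf (seq_pmf (map A ws)) (\<lambda>xs. bind_pmf (B w) (\<lambda>y.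
      bind_pmf (seq_pmf (map B ws)) (\<lambda>ys. return_pmf (x # xs, y # ys)))))"
    by (subst bind_commute_pmf) (rule refl)
  also have "\<dots> = pair_pmf (seq_pmf (map A (w # ws))) (seq_pmf (map B (w # ws)))"
    by (simp add: pair_pmf_def map_pmf_def bind_assoc_pmf bind_return_pmf)
  finally show ?case .
qed

lemma total_variation_unzip_list:
  fixes P Q :: "('a::finite \<times> 'b::finite) list pmf"
  assumes "set_pmf P \<subseteq> {zs. length zs = n}" "set_pmf Q \<subseteq> {zs. length zs = n}"
  shows "total_variation (map_pmf unzip_list P) (map_pmf unzip_list Q)
    = (\<Sum>zs | length zs = n. \<bar>pmf P zs - pmf Q zs\<bar>) / 2"
proof -
  have "total_variation (map_pmf unzip_list P) (map_pmf unzip_list Q)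
      = (\<Sum>z\<in>unzip_list ` {zs. length zs = n}. \<bar>pmf (map_pmf unzip_list P) z - pmf (map_pmf unzip_list Q) z\<bar>) / 2"
    using assms by (intro total_variation_finite) (auto simp: finite_lists_length)
  then show ?thesis
    by (simp add: sum.reindex inj_on_subset[OF inj_unzip_list] pmf_map_inj'[OF inj_unzip_list])
qed

lemma real_div_mult_power_mod:
  "real x = real (x div 2 ^ m) * 2 ^ m + real (x mod 2 ^ m)"
proof -
  have "real x = real (x div 2 ^ m * 2 ^ m + x mod 2 ^ m)" by (simp only: div_mult_mod_eq)
  then show ?thesis by (simp only: of_nat_add of_nat_mult of_nat_power of_nat_numeral)
qed

text \<open>Write \<open>n * a = j * 2 ^ m + r\<close>. Splitting \<open>r * 2 ^ (j - m)\<close>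
  leaves turns the fractional part \<open>r / 2 ^ m\<close> into \<open>card T / 2 ^ j\<close>; this
  uses \<open>m \<le> j\<close>, and \<open>r < 2 ^ m\<close> ensures that enough leaves
  exist.\<close>

lemma dyadic_rate_split:
  assumes m: "m \<le> n * a div 2 ^ m"
  obtains T :: "bool list set" where "T \<subseteq> {u. length u = n * a div 2 ^ m}"
    "real (n * a div 2 ^ m) + real (card T) / 2 ^ (n * a div 2 ^ m) = real n * (real a / 2 ^ m)"
proof -
  define j r where "j = n * a div 2 ^ m" and "r = n * a mod 2 ^ m"
  have pow: "(2 :: nat) ^ j = 2 ^ m * 2 ^ (j - m)"
    using m by (simp add: j_def flip: power_add)
  have "r * 2 ^ (j - m) \<le> card {u :: bool list. length u = j}"
    unfolding card_bool_lists_length pow by (intro mult_right_mono) (auto simp: r_def less_imp_le)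
  then obtain T :: "bool list set" where T: "T \<subseteq> {u. length u = j}" "card T = r * 2 ^ (j - m)"
    using obtain_subset_with_card_n by metis
  have "real (2 ^ j) = 2 ^ m * 2 ^ (j - m)" by (simp only: pow of_nat_mult of_nat_power of_nat_numeral)
  then have "real (card T) / 2 ^ j = real r / 2 ^ m" by (simp add: T(2))
  moreover have "real (n * a) = real j * 2 ^ m + real r"
    unfolding j_def r_def by (rule real_div_mult_power_mod)
  then have "real n * (real a / 2 ^ m) = real j + real r / 2 ^ m" by (simp add: field_simps)
  ultimately show thesis using T(1) that[of T] by (simp add: j_def)
qed

lemma expectation_information_density:
  fixes W :: "nat pmf" and A :: "nat \<Rightarrow> 'a::finite pmf" and B :: "nat \<Rightarrow> 'b::finite pmf"
  assumes fin: "finite (set_pmf W)" and p: "bind_pmf W (\<lambda>w. pair_pmf (A w) (B w)) = p"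
  shows "measure_pmf.expectation (channel_joint W (\<lambda>w. pair_pmf (A w) (B w)))
      (\<lambda>(w, z). log 2 (pmf (pair_pmf (A w) (B w)) z) - log 2 (pmf (bind_pmf W (\<lambda>w. pair_pmf (A w) (B w))) z))
    = pmf_entropy p - measure_pmf.expectation W (\<lambda>w. pmf_entropy (A w) + pmf_entropy (B w))"
    (is "measure_pmf.expectation _ ?i = _")
proof -
  have "measure_pmf.expectation (channel_joint W (\<lambda>w. pair_pmf (A w) (B w))) ?i
      = measure_pmf.expectation W (\<lambda>w. measure_pmf.expectation (map_pmf (Pair w) (pair_pmf (A w) (B w))) ?i)"
    unfolding channel_joint_def
    by (rule expectation_bind_finite[of "set_pmf W \<times> UNIV"]) (use fin in auto)
  then show ?thesis
    using mutual_information_channel_joint[of W "\<lambda>w. pair_pmf (A w) (B w)"] mutual_information_product_channel[OF p]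
    by simp
qed

lemma approximately_generable_dyadic:
  fixes p :: "('a::finite \<times> 'b::finite) pmf"
  assumes R: "wyner_common_information p < real a / 2 ^ m" and a: "0 < a"
  shows "approximately_generable p (real a / 2 ^ m)"
proof -
  define R where "R = real a / 2 ^ m"
  define k where "k n = n * a div 2 ^ m" for n
  obtain W :: "nat pmf" and A :: "nat \<Rightarrow> 'a pmf" and B :: "nat \<Rightarrow> 'b pmf"
    where fin: "finite (set_pmf W)" and p: "bind_pmf W (\<lambda>w. pair_pmf (A w) (B w)) = p"
      and J: "wyner_common_information p
        = pmf_entropy p - measure_pmf.expectation W (\<lambda>w. pmf_entropy (A w) + pmf_entropy (B w))"
  proof (rule wyner_common_information_characterization[of p])
    fix W :: "nat pmf" and A :: "nat \<Rightarrow> 'a pmf" and B :: "nat \<Rightarrow> 'b pmf"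
    assume "finite (set_pmf W)" "bind_pmf W (\<lambda>w. pair_pmf (A w) (B w)) = p"
      "wyner_common_information p
        = pmf_entropy p - measure_pmf.expectation W (\<lambda>w. pmf_entropy (A w) + pmf_entropy (B w))"
    then show thesis by (rule that)
  qed
  define V where "V w = pair_pmf (A w) (B w)" for w
  have pV: "bind_pmf W V = p" using p by (simp add: V_def[abs_def])
  have I: "measure_pmf.expectation (channel_joint W V)
    (\<lambda>(w, z). log 2 (pmf (V w) z) - log 2 (pmf (bind_pmf W V) z)) < R"
    using expectation_information_density[OF fin p] R unfolding J by (simp add: V_def[abs_def] R_def)
  have nR: "real n * R = real (k n) + real (n * a mod 2 ^ m) / 2 ^ m" for n
  proof -
    have "real (n * a) = real (k n) * 2 ^ m + real (n * a mod 2 ^ m)"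
      unfolding k_def by (rule real_div_mult_power_mod)
    then show ?thesis by (simp add: R_def field_simps)
  qed
  have k: "real n * R - 1 \<le> real (k n)" for n
  proof -
    have "real (n * a mod 2 ^ m) \<le> real (2 ^ m)" by (subst of_nat_le_iff) (simp add: less_imp_le)
    then show ?thesis unfolding nR by (simp add: divide_le_eq)
  qed
  obtain cs :: "nat \<Rightarrow> nat list list" and b :: "nat \<Rightarrow> real" where b: "b \<longlonglongrightarrow> 0"
    and len: "\<And>n. length (cs n) = 2 ^ k n" and lenw: "\<And>n ws. ws \<in> set (cs n) \<Longrightarrow> length ws = n"
    and cover: "\<And>n. (\<Sum>zs | length zs = n. \<bar>sum_list (map (\<lambda>ws. pmf (seq_pmf (map V ws)) zs) (cs n)) / 2 ^ k n
      - pmf (replicate_pmf n (bind_pmf W V)) zs\<bar>) \<le> b n"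
  proof (rule soft_covering[OF fin I k])
    fix cs :: "nat \<Rightarrow> nat list list" and b :: "nat \<Rightarrow> real"
    assume "b \<longlonglongrightarrow> 0" "\<And>n. length (cs n) = 2 ^ k n" "\<And>n ws. ws \<in> set (cs n) \<Longrightarrow> length ws = n"
      "\<And>n. (\<Sum>zs | length zs = n. \<bar>sum_list (map (\<lambda>ws. pmf (seq_pmf (map V ws)) zs) (cs n)) / 2 ^ k n
        - pmf (replicate_pmf n (bind_pmf W V)) zs\<bar>) \<le> b n"
    then show thesis by (rule that)
  qed
  have "\<forall>n. \<exists>e. bij_betw e {u :: bool list. length u = k n} {0..<(2::nat) ^ k n}"
    using ex_bij_betw_finite_nat[OF finite_lists_length[where 'a = bool]]
    by (simp add: card_bool_lists_length)
  from choice[OF this] obtain e :: "nat \<Rightarrow> bool list \<Rightarrow> nat"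
    where e: "\<And>n. bij_betw (e n) {u. length u = k n} {0..<2 ^ k n}" by blast
  \<comment> \<open>While \<open>k n < m\<close> no leaf set is prescribed: the rate is demanded
    only eventually, and the output law does not depend on \<open>T n\<close>.\<close>
  have "\<forall>n. \<exists>T :: bool list set. m \<le> k n \<longrightarrow> T \<subseteq> {u. length u = k n} \<and> real (k n) + real (card T) / 2 ^ k n = real n * R"
  proof
    fix n
    show "\<exists>T :: bool list set. m \<le> k n \<longrightarrow> T \<subseteq> {u. length u = k n} \<and> real (k n) + real (card T) / 2 ^ k n = real n * R"
    proof (cases "m \<le> k n")
      case True
      show ?thesis
        unfolding k_def R_def by (rule dyadic_rate_split[OF True[unfolded k_def]]) blast
    qed simp
  qed
  from choice[OF this] obtain T :: "nat \<Rightarrow> bool list set"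
    where T: "\<And>n. m \<le> k n \<Longrightarrow> T n \<subseteq> {u. length u = k n} \<and> real (k n) + real (card (T n)) / 2 ^ k n = real n * R" by blast
  define word where "word n u = cs n ! e n u" for n u
  define X where "X n = split_index (k n) (T n)" for n
  \<comment> \<open>The decoders drop the extra bit, if any, and look up the codeword of the first
    \<open>k n\<close> bits.\<close>
  define decX where "decX n w = seq_pmf (map A (word n (take (k n) (from_nat w))))" for n w
  define decY where "decY n w = seq_pmf (map B (word n (take (k n) (from_nat w))))" for n w
  define P where "P n = bind_pmf (pmf_of_set {u. length u = k n}) (\<lambda>u. seq_pmf (map V (word n u)))" for n
  have word: "length (word n u) = n" if "length u = k n" for n u
  proof -
    have "e n u < 2 ^ k n" using bij_betwE[OF e[of n]] that by auto
    then show ?thesis unfolding word_def using len by (intro lenw nth_mem) simp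
  qed
  have outcome: "code_output (X n) (decX n) (decY n) = map_pmf unzip_list (P n)" for n
  proof -
    have "code_output (X n) (decX n) (decY n)
        = bind_pmf (split_tree (k n) (T n)) (\<lambda>v. map_pmf unzip_list (seq_pmf (map V (word n (take (k n) v)))))"
      by (simp add: code_output_def X_def split_index_def bind_map_pmf decX_def decY_def V_def[abs_def] unzip_seq_pmf_pair)
    also have "\<dots> = bind_pmf (map_pmf (take (k n)) (split_tree (k n) (T n))) (\<lambda>u. map_pmf unzip_list (seq_pmf (map V (word n u))))"
      by (simp add: bind_map_pmf)
    finally show ?thesis by (simp add: map_take_split_tree P_def map_bind_pmf)
  qed
  have TV: "total_variation (code_output (X n) (decX n) (decY n)) (memoryless_source p n) \<le> b n / 2" for n
  proof -
    have pmf_P: "pmf (P n) zs = sum_list (map (\<lambda>ws. pmf (seq_pmf (map V ws)) zs) (cs n)) / 2 ^ k n" for zs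
    proof -
      have "pmf (P n) zs = (\<Sum>u | length u = k n. pmf (seq_pmf (map V (cs n ! e n u))) zs) / 2 ^ k n"
        unfolding P_def word_def
        by (subst pmf_bind_pmf_of_set[OF bool_lists_length_nonempty finite_lists_length])
      (simp add: card_bool_lists_length)
      also have "(\<Sum>u | length u = k n. pmf (seq_pmf (map V (cs n ! e n u))) zs)
          = (\<Sum>i\<in>{0..<2 ^ k n}. pmf (seq_pmf (map V (cs n ! i))) zs)"
        by (rule sum.reindex_bij_betw[OF e])
      finally show ?thesis by (simp add: sum_list_sum_nth len)
    qed
    have "set_pmf (P n) \<subseteq> {zs. length zs = n}"
      using word by (auto simp: P_def set_pmf_uniform_bool_lists dest!: length_seq_pmf)
    moreover have "set_pmf (replicate_pmf n p) \<subseteq> {zs. length zs = n}" by (auto simp: set_replicate_pmf)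
    ultimately show ?thesis
      unfolding outcome memoryless_source_eq using cover[of n]
      by (simp add: total_variation_unzip_list pmf_P pV divide_right_mono)
  qed
  have "(\<lambda>n. total_variation (code_output (X n) (decX n) (decY n)) (memoryless_source p n)) \<longlonglongrightarrow> 0"
  proof (rule tendsto_sandwich[OF _ _ tendsto_const])
    show "(\<lambda>n. b n / 2) \<longlonglongrightarrow> 0" using b by (rule tendsto_divide_zero)
    show "\<forall>\<^sub>F n in sequentially. 0 \<le> total_variation (code_output (X n) (decX n) (decY n)) (memoryless_source p n)"
      by (simp add: total_variation_def infsum_nonneg)
  qed (intro always_eventually allI TV)
  moreover have "\<forall>\<^sub>F n in sequentially. simulation_code (X n) (decX n) (decY n) R n"
    \<comment> \<open>The threshold gives \<open>n * a \<ge> m * 2 ^ m\<close> and so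
      \<open>k n \<ge> m\<close>; \<open>Suc\<close> keeps it positive when
      \<open>m = 0\<close>.\<close>
    using eventually_ge_at_top[of "Suc m * 2 ^ m"]
  proof eventually_elim
    case (elim n)
    have "0 < Suc m * 2 ^ m" by simp
    also note elim
    finally have n: "0 < n" .
    have "m * 2 ^ m \<le> Suc m * 2 ^ m" by simp
    also note elim
    also have "n \<le> n * a" using a by simp
    finally have "m * 2 ^ m \<le> n * a" .
    then have mk: "m \<le> k n" by (simp add: k_def less_eq_div_iff_mult_less_eq)
    have "is_min_expected_length (X n) (ennreal (real n * R))"
      using is_min_expected_length_split_index[of "T n" "k n"] T[OF mk] by (simp add: X_def)
    moreover have "length (take (k n) (from_nat w :: bool list)) = k n" if "w \<in> set_pmf (X n)" for w
      using that length_split_tree_ge by (force simp: X_def split_index_def)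
    ultimately show ?case
      using n word by (auto simp: simulation_code_def R_def decX_def decY_def dest!: length_seq_pmf)
  qed
  ultimately show ?thesis unfolding approximately_generable_def R_def by blast
qed

text \<open>Gibbs' inequality for each conditional law against \<open>p\<close>. It allows rates
  just above the common information to be dyadic with a natural numerator.\<close>

lemma wyner_common_information_nonneg:
  fixes p :: "('a::finite \<times> 'b::finite) pmf"
  shows "0 \<le> wyner_common_information p"
proof (rule wyner_common_information_characterization[of p])
  fix W :: "nat pmf" and A :: "nat \<Rightarrow> 'a pmf" and B :: "nat \<Rightarrow> 'b pmf"
  assume p: "bind_pmf W (\<lambda>w. pair_pmf (A w) (B w)) = p"
    and J: "wyner_common_information p
      = pmf_entropy p - measure_pmf.expectation W (\<lambda>w. pmf_entropy (A w) + pmf_entropy (B w))"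
  let ?V = "\<lambda>w. pair_pmf (A w) (B w)"
  have "measure_pmf.expectation W (\<lambda>w. pmf_entropy (A w) + pmf_entropy (B w))
      \<le> measure_pmf.expectation W (\<lambda>w. measure_pmf.expectation (?V w) (\<lambda>z. - log 2 (pmf p z)))"
  proof (intro integral_mono_AE Bochner_Integration.integrable_add integrable_pmf_entropy integrable_expectation_finite_type)
    have "pmf_entropy (A w) + pmf_entropy (B w) \<le> measure_pmf.expectation (?V w) (\<lambda>z. - log 2 (pmf p z))"
      if "w \<in> set_pmf W" for w
    proof -
      have "set_pmf (?V w) \<subseteq> set_pmf p" using that unfolding p[symmetric] set_bind_pmf by blast
      then have "pmf_entropy (?V w) \<le> measure_pmf.expectation (?V w) (\<lambda>z. - log 2 (pmf p z))"
        by (intro pmf_gibbs) auto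
      then show ?thesis by (simp add: pmf_entropy_pair)
    qed
    then show "AE w in measure_pmf W. pmf_entropy (A w) + pmf_entropy (B w)
        \<le> measure_pmf.expectation (?V w) (\<lambda>z. - log 2 (pmf p z))"
      by (simp add: AE_measure_pmf_iff)
  qed
  also have "\<dots> = pmf_entropy p"
    unfolding pmf_entropy_def by (subst expectation_bind_finite_type[symmetric]) (simp only: p)
  finally show ?thesis by (simp add: J)
qed

text \<open>The grid of step \<open>1 / 2 ^ m\<close> is finer than \<open>y - x\<close>; adding 1
  to the floor makes the lower inequality strict and the numerator positive.\<close>

lemma dyadic_between:
  fixes x y :: real
  assumes "0 \<le> x" "x < y"
  obtains a m :: nat where "0 < a" "x < real a / 2 ^ m" "real a / 2 ^ m < y"
proof -
  obtain m :: nat where m: "1 / (y - x) < 2 ^ m"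
    using real_arch_pow[of 2 "1 / (y - x)"] by auto
  define a where "a = nat \<lfloor>x * 2 ^ m\<rfloor> + 1"
  have a: "real a = of_int \<lfloor>x * 2 ^ m\<rfloor> + 1" using assms by (simp add: a_def)
  have "x * 2 ^ m < real a" unfolding a by linarith
  moreover have "real a \<le> x * 2 ^ m + 1" unfolding a by linarith
  moreover have "1 < (y - x) * 2 ^ m" using m assms by (simp add: field_simps)
  ultimately show thesis
    using that[of a m] by (simp add: field_simps a_def)
qed

theorem proposition4:
  fixes p :: "('a::finite \<times> 'b::finite) pmf"
  shows "approximate_common_information_rate p = wyner_common_information p"
proof -
  define J where "J = wyner_common_information p"
  define G where "G = {R. approximately_generable p R}"
  have lower: "J \<le> R" if "R \<in> G" for R
    using that by (simp add: J_def G_def approximately_generable_imp_rate_ge)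
  have upper: "\<exists>R\<in>G. R < y" if y: "J < y" for y
  proof (rule dyadic_between[OF _ y])
    show "0 \<le> J" by (simp add: J_def wyner_common_information_nonneg)
  next
    fix a m :: nat assume am: "0 < a" "J < real a / 2 ^ m" "real a / 2 ^ m < y"
    then have "real a / 2 ^ m \<in> G"
      unfolding G_def mem_Collect_eq J_def by (intro approximately_generable_dyadic)
    then show ?thesis using am(3) by blast
  qed
  have "Inf G = J"
  proof (rule cInf_eq_non_empty)
    show "G \<noteq> {}" using upper[of "J + 1"] by auto
    show "y \<le> J" if "\<And>R. R \<in> G \<Longrightarrow> y \<le> R" for y
      using that upper[of y] by (meson not_le)
  qed (rule lower)
  then show ?thesis by (simp add: approximate_common_information_rate_def G_def J_def)
qed

end
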